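(* Let $n\ge1$. The exceptional sets for the quiver of type $\mathbb A_n$ with straight orientation are in bijection with rooted ternary trees with $n$ nodes (and $2n+1$ leaves), where each node is labeled with an object of the exceptional set: the bijection sends an exceptional set to the ternary tree whose nodes are its objects, with root $R$ and with the three ordered children of a node $X$ being $Xa,Xb,Xc$, as defined in the context (a leaf being placed wherever the corresponding strand does not exist).
   Context: The quiver is $1\to2\to\cdots\to n$ over a field $\Bbbk$; modules are finite dimensional up to isomorphism. For $0\le i<j\le n$, $M_{i,j}$ is the indecomposable module with support $(i,j]=\{i+1,\dots,j\}$. An exceptional set is a set of $n$ indecomposable modules which can be ordered as a sequence $(V_1,\dots,V_n)$ of exceptional modules with $\mathrm{Hom}(V_p,V_q)=0=\mathrm{Ext}^1(V_p,V_q)$ for $q<p$. The strand diagram of an exceptional set is the graph with vertex set $\{0,1,\dots,n\}$ and an edge (strand) $c(i,j)$ joining $i$ and $j$ for each object $M_{i,j}$ of the set; it is known to be a tree. Take $0$ as its root. A strand $c(i,j)$, $i<j$, is oriented to the right if the unique path from $0$ to $j$ passes through $i$, and oriented to the left otherwise. A rooted ternary tree is a finite rooted plane tree whose vertices are nodes and leaves, each node having exactly three ordered children (each a node or a leaf) and leaves having none. The root $R$ is the strand $c(0,k)$ with $k$ maximal such that $M_{0,k}$ is in the set. For a strand $X=c(i,j)$, $i<j$, of the diagram: - if $X$ is oriented to the right: $Xa=c(i,x)$ with $i<x<j$ and $x$ maximal; $Xb=c(y,j)$ the longest strand with $i<y<j$; $Xc=c(j,z)$ with $z>j$ maximal; -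 if $X$ is oriented to the left: $Xa=c(x,j)$ with $i<x<j$ and $x$ minimal; $Xb=c(i,y)$ the longest strand with $i<y<j$; $Xc=c(z,i)$ the longest strand with $z<i$; in each case among strands of the diagram, and if no such strand exists the corresponding child of $X$ is a leaf. *)

theory Defs
  imports
    "Jordan_Normal_Form.Matrix_Kernel"
    "Jordan_Normal_Form.VS_Connect"
begin

section \<open>Representations of the linear quiver\<close>

text \<open>
  A finite dimensional representation of \<open>1 \<rightarrow> 2 \<rightarrow> \<dots> \<rightarrow> n\<close> over a field, with the space at the
  vertex \<open>m\<close> being \<open>k^(dim_at V m)\<close>, and \<open>arrow V m\<close> the matrix of the map from the space at \<open>m\<close> to
  the space at \<open>m + 1\<close>.  Only the dimensions at \<open>1, \<dots>, n\<close> and the arrows \<open>1, \<dots>, n - 1\<close> are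
  relevant; the other values are junk, and isomorphism of representations ignores them.
\<close>

datatype 'k rep = Rep (dim_at: "nat \<Rightarrow> nat") (arrow: "nat \<Rightarrow> 'k mat")

definition reps :: "nat \<Rightarrow> 'k::field rep set" where
  "reps n = {V. \<forall>m\<in>{1..<n}. arrow V m \<in> carrier_mat (dim_at V (m + 1)) (dim_at V m)}"

definition homs :: "nat \<Rightarrow> 'k::field rep \<Rightarrow> 'k rep \<Rightarrow> (nat \<Rightarrow> 'k mat) set" where
  "homs n V W = {f.
     (\<forall>m\<in>{1..n}. f m \<in> carrier_mat (dim_at W m) (dim_at V m)) \<and>
     (\<forall>m\<in>{1..<n}. f (m + 1) * arrow V m = arrow W m * f m)}"

definition Hom_zero :: "nat \<Rightarrow> 'k::field rep \<Rightarrow> 'k rep \<Rightarrow> bool" where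
  "Hom_zero n V W \<longleftrightarrow>
     (\<forall>f\<in>homs n V W. \<forall>m\<in>{1..n}. f m = 0\<^sub>m (dim_at W m) (dim_at V m))"

definition isomorphic :: "nat \<Rightarrow> 'k::field rep \<Rightarrow> 'k rep \<Rightarrow> bool" where
  "isomorphic n V W \<longleftrightarrow> (\<exists>f\<in>homs n V W. \<exists>g\<in>homs n W V. \<forall>m\<in>{1..n}.
     g m * f m = 1\<^sub>m (dim_at V m) \<and> f m * g m = 1\<^sub>m (dim_at W m))"

definition iso_class :: "nat \<Rightarrow> 'k::field rep \<Rightarrow> 'k rep set" where
  "iso_class n V = {W \<in> reps n. isomorphic n V W}"

definition short_exact ::
  "nat \<Rightarrow> 'k::field rep \<Rightarrow> (nat \<Rightarrow> 'k mat) \<Rightarrow> 'k rep \<Rightarrow> (nat \<Rightarrow> 'k mat) \<Rightarrow> 'k rep \<Rightarrow> bool" where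
  "short_exact n W f E g V \<longleftrightarrow> f \<in> homs n W E \<and> g \<in> homs n E V \<and>
     (\<forall>m\<in>{1..n}.
        inj_on ((*\<^sub>v) (f m)) (carrier_vec (dim_at W m)) \<and>
        (*\<^sub>v) (f m) ` carrier_vec (dim_at W m) = mat_kernel (g m) \<and>
        (*\<^sub>v) (g m) ` carrier_vec (dim_at E m) = carrier_vec (dim_at V m))"

text \<open>
  \<open>Ext\<^sup>1(V,W)\<close> is taken in the sense of Yoneda: it vanishes iff every short exact sequence
  \<open>0 \<rightarrow> W \<rightarrow> E \<rightarrow> V \<rightarrow> 0\<close> splits.
\<close>

definition Ext1_zero :: "nat \<Rightarrow> 'k::field rep \<Rightarrow> 'k rep \<Rightarrow> bool" where
  "Ext1_zero n V W \<longleftrightarrow> (\<forall>E\<in>reps n. \<forall>f g. short_exact n W f E g V \<longrightarrow>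
     (\<exists>s\<in>homs n V E. \<forall>m\<in>{1..n}. g m * s m = 1\<^sub>m (dim_at V m)))"

definition subrep :: "nat \<Rightarrow> 'k::field rep \<Rightarrow> (nat \<Rightarrow> 'k vec set) \<Rightarrow> bool" where
  "subrep n V U \<longleftrightarrow>
     (\<forall>m\<in>{1..n}. VectorSpace.subspace class_ring (U m) (module_vec TYPE('k) (dim_at V m))) \<and>
     (\<forall>m\<in>{1..<n}. (*\<^sub>v) (arrow V m) ` U m \<subseteq> U (m + 1))"

text \<open>Nonzero, and not the internal direct sum of two nonzero subrepresentations.\<close>

definition indecomposable :: "nat \<Rightarrow> 'k::field rep \<Rightarrow> bool" where
  "indecomposable n V \<longleftrightarrow> V \<in> reps n \<and> (\<exists>m\<in>{1..n}. dim_at V m \<noteq> 0) \<and>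
     (\<forall>U W. subrep n V U \<and> subrep n V W \<and>
        (\<forall>m\<in>{1..n}. {u + w | u w. u \<in> U m \<and> w \<in> W m} = carrier_vec (dim_at V m) \<and>
                     U m \<inter> W m = {0\<^sub>v (dim_at V m)}) \<longrightarrow>
        (\<forall>m\<in>{1..n}. U m = {0\<^sub>v (dim_at V m)}) \<or> (\<forall>m\<in>{1..n}. W m = {0\<^sub>v (dim_at V m)}))"

definition exceptional :: "nat \<Rightarrow> 'k::field rep \<Rightarrow> bool" where
  "exceptional n V \<longleftrightarrow> indecomposable n V \<and> Ext1_zero n V V"

definition exceptional_sequence :: "nat \<Rightarrow> 'k::field rep list \<Rightarrow> bool" where
  "exceptional_sequence n Vs \<longleftrightarrow> (\<forall>V\<in>set Vs. exceptional n V) \<and>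
     (\<forall>p<length Vs. \<forall>q<p. Hom_zero n (Vs ! p) (Vs ! q) \<and> Ext1_zero n (Vs ! p) (Vs ! q))"

text \<open>Modules are considered up to isomorphism, so the objects of an exceptional set are
  isomorphism classes.\<close>

definition exceptional_sets :: "nat \<Rightarrow> 'k::field rep set set set" where
  "exceptional_sets n = {S. card S = n \<and>
     (\<exists>Vs. length Vs = n \<and> exceptional_sequence n Vs \<and> S = iso_class n ` set Vs)}"

text \<open>\<open>M\<^sub>i\<^sub>,\<^sub>j\<close>: one-dimensional at the vertices \<open>i + 1, \<dots>, j\<close>, with identity maps between them.\<close>

definition interval_module :: "nat \<Rightarrow> nat \<Rightarrow> 'k::field rep" where
  "interval_module i j =
     (let d = (\<lambda>m. if i < m \<and> m \<le> j then 1 else 0)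
      in Rep d (\<lambda>m. if i < m \<and> m < j then 1\<^sub>m 1 else 0\<^sub>m (d (m + 1)) (d m)))"


section \<open>Strand diagrams\<close>

text \<open>The strand \<open>c(i,j)\<close> with \<open>i < j\<close> is the pair \<open>(i, j)\<close>.\<close>

type_synonym strand = "nat \<times> nat"

definition strands :: "nat \<Rightarrow> 'k::field rep set set \<Rightarrow> strand set" where
  "strands n S = {(i, j). i < j \<and> j \<le> n \<and> iso_class n (interval_module i j) \<in> S}"

definition simple_path :: "strand set \<Rightarrow> nat \<Rightarrow> nat \<Rightarrow> nat list \<Rightarrow> bool" where
  "simple_path D u v p \<longleftrightarrow> p \<noteq> [] \<and> hd p = u \<and> last p = v \<and> distinct p \<and>
     successively (\<lambda>x y. (x, y) \<in> D \<or> (y, x) \<in> D) p"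

text \<open>Strand diagrams of exceptional sets are trees, so the path described here is unique.\<close>

definition oriented_right :: "strand set \<Rightarrow> strand \<Rightarrow> bool" where
  "oriented_right D = (\<lambda>(i, j). i \<in> set (THE p. simple_path D 0 j p))"

definition root_strand :: "strand set \<Rightarrow> strand" where
  "root_strand D = (0, Max {k. (0, k) \<in> D})"

definition longest :: "strand set \<Rightarrow> strand option" where
  "longest A = (if A = {} then None else Some (ARG_MAX (\<lambda>(i, j). j - i) X. X \<in> A))"

definition child_a :: "strand set \<Rightarrow> strand \<Rightarrow> strand option" where
  "child_a D = (\<lambda>(i, j).
     let A = (if oriented_right D (i, j) then {x. i < x \<and> x < j \<and> (i, x) \<in> D}
              else {x. i < x \<and> x < j \<and> (x, j) \<in> D})
     in if A = {} then None
        else Some (if oriented_right D (i, j) then (i, Max A) else (Min A, j)))"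

definition child_b :: "strand set \<Rightarrow> strand \<Rightarrow> strand option" where
  "child_b D = (\<lambda>(i, j).
     if oriented_right D (i, j) then longest {(y, j) | y. i < y \<and> y < j \<and> (y, j) \<in> D}
     else longest {(i, y) | y. i < y \<and> y < j \<and> (i, y) \<in> D})"

definition child_c :: "strand set \<Rightarrow> strand \<Rightarrow> strand option" where
  "child_c D = (\<lambda>(i, j).
     if oriented_right D (i, j) then
       (let A = {z. z > j \<and> (j, z) \<in> D} in if A = {} then None else Some (j, Max A))
     else longest {(z, i) | z. z < i \<and> (z, i) \<in> D})"


section \<open>Ternary trees\<close>

datatype 'l ttree = Leaf | Node 'l "'l ttree" "'l ttree" "'l ttree"

fun node_labels :: "'l ttree \<Rightarrow> 'l list" where
  "node_labels Leaf = []"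
| "node_labels (Node x a b c) = x # node_labels a @ node_labels b @ node_labels c"

fun num_nodes :: "'l ttree \<Rightarrow> nat" where
  "num_nodes Leaf = 0"
| "num_nodes (Node x a b c) = 1 + num_nodes a + num_nodes b + num_nodes c"

fun num_leaves :: "'l ttree \<Rightarrow> nat" where
  "num_leaves Leaf = 1"
| "num_leaves (Node x a b c) = num_leaves a + num_leaves b + num_leaves c"

text \<open>Rooted ternary trees without labels are represented as trees labelled in the unit type.\<close>

definition shape :: "'l ttree \<Rightarrow> unit ttree" where
  "shape = map_ttree (\<lambda>_. ())"

text \<open>
  \<open>grows D r t\<close>: the tree \<open>t\<close> has root \<open>r\<close>, and the children of each node \<open>X\<close> of \<open>t\<close> are those
  prescribed by the diagram \<open>D\<close>; a missing strand \<open>None\<close> is a leaf.  That a (finite) tree with given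
  root exists is not part of the definition.
\<close>

inductive grows :: "strand set \<Rightarrow> strand option \<Rightarrow> strand ttree \<Rightarrow> bool" for D where
  leaf: "grows D None Leaf"
| node: "grows D (child_a D X) ta \<Longrightarrow> grows D (child_b D X) tb \<Longrightarrow> grows D (child_c D X) tc
         \<Longrightarrow> grows D (Some X) (Node X ta tb tc)"

definition is_strand_tree :: "nat \<Rightarrow> 'k::field rep set set \<Rightarrow> strand ttree \<Rightarrow> bool" where
  "is_strand_tree n S t \<longleftrightarrow> grows (strands n S) (Some (root_strand (strands n S))) t"

definition object_tree :: "nat \<Rightarrow> 'k::field rep set set \<Rightarrow> 'k rep set ttree" where
  "object_tree n S =
     map_ttree (\<lambda>(i, j). iso_class n (interval_module i j)) (THE t. is_strand_tree n S t)"

end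

theory Submission
  imports Defs
begin

text \<open>
  Every indecomposable representation is an interval module; \<open>Hom(M\<^sub>i\<^sub>,\<^sub>j, M\<^sub>k\<^sub>,\<^sub>l)\<close> is nonzero iff
  \<open>k \<le> i < l \<le> j\<close>, and \<open>Ext\<^sup>1(M\<^sub>i\<^sub>,\<^sub>j, M\<^sub>k\<^sub>,\<^sub>l)\<close> is nonzero iff \<open>i < k \<le> j < l\<close>.  Hence exceptional sets are
  the sets of \<open>n\<close> strands on which the union of these two relations is acyclic.  Crossing
  strands violate acyclicity, and so does a chain of strands from \<open>p\<close> to \<open>q\<close> below \<open>c(p,q)\<close>.  If
  \<open>c(p,q)\<close> is the longest strand at \<open>p\<close> (the leftmost vertex), the diagram therefore falls apart into
  \<open>c(p,q)\<close> and diagrams on \<open>[p,m]\<close>, \<open>[m+1,q]\<close> and \<open>[q,n]\<close>, and a count shows that each of them has the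
  maximal number of strands.  Iterating this, alternately from the left and from the right, produces
  the ternary tree, and conversely the sizes of the subtrees determine the positions of the strands.
\<close>

section \<open>Strand diagrams and ternary trees\<close>

text \<open>The bound in the count is the number of unit steps in the vertex range. The three pieces
  admit at most \<open>m - p\<close>, \<open>q - m - 1\<close> and \<open>n - q\<close> strands,
  which together with \<open>c(p,q)\<close> is exactly \<open>n - p\<close>, so equality passes down
  to every piece. The piece on \<open>[m+1,q]\<close> hangs at \<open>q\<close> and extends to the
  left; this is why right and left placements of trees are mutually recursive. Two features of the
  definitions shape what follows. Orientation refers to a path in the undirected diagram; it is
  computed by directing the edges of a placed tree away from 0 and showing that simple paths from 0
  must follow these directions. The children of a strand are selected from the whole diagram, so the
  induction over subtrees carries a locality condition: apart from the point where it is attached,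
  the vertices of a subtree meet only its own strands. On the algebraic side, vanishing of Ext is
  proved by lifting a generator of the interval module and correcting the lift, and non-vanishing by
  an explicit cocycle that is not a coboundary.\<close>

text \<open>The first disjunct is \<open>Hom(M\<^sub>i\<^sub>,\<^sub>j, M\<^sub>k\<^sub>,\<^sub>l) \<noteq> 0\<close>, the second one \<open>Ext\<^sup>1(M\<^sub>i\<^sub>,\<^sub>j, M\<^sub>k\<^sub>,\<^sub>l) \<noteq> 0\<close>.\<close>

definition nonorth :: "strand \<Rightarrow> strand \<Rightarrow> bool" where
  "nonorth = (\<lambda>(i, j) (k, l). (k \<le> i \<and> i < l \<and> l \<le> j) \<or> (i < k \<and> k \<le> j \<and> j < l))"

text \<open>\<open>sorted_wrt\<close> pairs an earlier \<open>X\<close> with a later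
  \<open>Y\<close>; morphisms and extensions from later to earlier objects are the forbidden ones,
  as in \<open>exceptional_sequence\<close>.\<close>

definition exc_list :: "strand list \<Rightarrow> bool" where
  "exc_list = sorted_wrt (\<lambda>X Y. \<not> nonorth Y X)"

definition strands_on :: "nat \<Rightarrow> nat \<Rightarrow> strand set" where
  "strands_on u v = {(i, j). u \<le> i \<and> i < j \<and> j \<le> v}"

lemma finite_strands_on [simp]: "finite (strands_on u v)"
  by (rule finite_subset[of _ "{..v} \<times> {..v}"]) (auto simp: strands_on_def)

text \<open>\<open>nonorth X X\<close> holds for every strand (the identity morphism), so a repeated
  entry would violate the order condition.\<close>

lemma exc_list_distinct: "exc_list xs \<Longrightarrow> (\<And>X. X \<in> set xs \<Longrightarrow> fst X < snd X) \<Longrightarrow> distinct xs"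
  unfolding exc_list_def
  by (induction xs) (auto simp: nonorth_def)

text \<open>The position in the list serves as rank, since \<open>nonorth\<close> can only point
  forward. A rank function expresses acyclicity in a form that restricts to arbitrary subsets, which
  the recursive splitting requires.\<close>

lemma exc_list_rank:
  assumes "exc_list xs"
  shows "\<exists>\<rho>::strand \<Rightarrow> nat. \<forall>X\<in>set xs. \<forall>Y\<in>set xs. X \<noteq> Y \<and> nonorth X Y \<longrightarrow> \<rho> X < \<rho> Y"
  using assms unfolding exc_list_def
proof (induction xs)
  case (Cons Z xs)
  then obtain \<rho> :: "strand \<Rightarrow> nat"
    where \<rho>: "\<forall>X\<in>set xs. \<forall>Y\<in>set xs. X \<noteq> Y \<and> nonorth X Y \<longrightarrow> \<rho> X < \<rho> Y"
    by auto
  have "\<forall>X\<in>set xs. \<not> nonorth X Z"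
    using Cons.prems by simp
  then show ?case
    using \<rho> by (intro exI[of _ "\<lambda>X. if X = Z then 0 else Suc (\<rho> X)"]) auto
qed simp

section \<open>Acyclic diagrams and their splitting along a longest strand\<close>

definition ranked :: "(strand \<Rightarrow> nat) \<Rightarrow> strand set \<Rightarrow> bool" where
  "ranked \<rho> D \<longleftrightarrow> (\<forall>X\<in>D. \<forall>Y\<in>D. X \<noteq> Y \<and> nonorth X Y \<longrightarrow> \<rho> X < \<rho> Y)"

lemma ranked_subset: "ranked \<rho> D \<Longrightarrow> D' \<subseteq> D \<Longrightarrow> ranked \<rho> D'"
  unfolding ranked_def by blast

lemma ranked_less: "ranked \<rho> D \<Longrightarrow> X \<in> D \<Longrightarrow> Y \<in> D \<Longrightarrow> X \<noteq> Y \<Longrightarrow> nonorth X Y \<Longrightarrow> \<rho> X < \<rho> Y"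
  unfolding ranked_def by blast

text \<open>Crossing strands form a 2-cycle: there is an extension from the left one to the right
  one and a morphism back.\<close>

lemma ranked_noncrossing:
  assumes "ranked \<rho> D" "(i, j) \<in> D" "(k, l) \<in> D" "i < k" "k < j" "j < l"
  shows False
proof -
  have "nonorth (i, j) (k, l)" "nonorth (k, l) (i, j)"
    using assms by (auto simp: nonorth_def)
  then show False
    using ranked_less[OF assms(1-3)] ranked_less[OF assms(1,3,2)] assms(4) by fastforce
qed

text \<open>The number \<open>m\<close> marks a unit step from \<open>m\<close> to
  \<open>m + 1\<close> that no strand other than \<open>(p, q)\<close> passes over. Without such a
  step the inclusion-maximal strands would chain up from \<open>p\<close> to \<open>q\<close>, with
  rank increasing by Ext; the morphisms from the last link to \<open>(p, q)\<close> and from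
  \<open>(p, q)\<close> to the first link would close a cycle.\<close>

lemma ranked_split:
  assumes r: "ranked \<rho> D" and on: "D \<subseteq> strands_on p q" and pq: "(p, q) \<in> D"
  shows "\<exists>m. p \<le> m \<and> m < q \<and>
    D = insert (p, q) ((D \<inter> strands_on p m) \<union> (D \<inter> strands_on (Suc m) q))"
proof (rule ccontr)
  assume nex: "\<not> ?thesis"
  define D' where "D' = D - {(p, q)}"
  have D': "D' \<subseteq> D" "(p, q) \<notin> D'" and fin: "finite D'"
    using finite_subset[OF on] by (auto simp: D'_def)
  have "p < q"
    using on pq by (auto simp: strands_on_def)
  have cover: "\<exists>a b. (a, b) \<in> D' \<and> a \<le> m \<and> m < b" if "p \<le> m" "m < q" for m
  proof (rule ccontr)
    assume "\<not> ?thesis"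
    then have "D = insert (p, q) ((D \<inter> strands_on p m) \<union> (D \<inter> strands_on (Suc m) q))"
      using on pq by (fastforce simp: D'_def strands_on_def not_le not_less Suc_le_eq)
    then show False
      using nex that by blast
  qed
  \<comment> \<open>A local predicate, distinct from the constant \<open>longest\<close> in the
    definition of children: maximality under inclusion among the strands other than
    \<open>(p, q)\<close>.\<close>
  define longest where "longest a b \<longleftrightarrow>
    (a, b) \<in> D' \<and> (\<forall>c d. (c, d) \<in> D' \<and> c \<le> a \<and> b \<le> d \<longrightarrow> c = a \<and> d = b)" for a b
  have longest_cover: "\<exists>a b. longest a b \<and> a \<le> m \<and> m < b" if "p \<le> m" "m < q" for m
  proof -
    define A where "A = {X \<in> D'. fst X \<le> m \<and> m < snd X}"
    have "finite A" "A \<noteq> {}"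
      using fin cover[OF that] by (auto simp: A_def)
    \<comment> \<open>A strand containing \<open>X\<close> also passes over the step at
      \<open>m\<close>, so maximal length among the strands over this step gives maximality under
      inclusion.\<close>
    then obtain X where X: "X \<in> A" "\<And>Y. Y \<in> A \<Longrightarrow> snd Y - fst Y \<le> snd X - fst X"
      using Max_in[of "(\<lambda>X. snd X - fst X) ` A"] Max_ge[of "(\<lambda>X. snd X - fst X) ` A"]
      by (smt (verit) finite_imageI image_iff image_is_empty)
    have "longest (fst X) (snd X)"
      unfolding longest_def
    proof (intro conjI allI impI; (elim conjE)?)
      show "(fst X, snd X) \<in> D'"
        using X by (simp add: A_def)
      fix c d assume cd: "(c, d) \<in> D'" "c \<le> fst X" "snd X \<le> d"
      then have "(c, d) \<in> A"
        using X(1) by (auto simp: A_def)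
      from X(2)[OF this] cd show "c = fst X" "d = snd X"
        using X(1) by (auto simp: A_def)
    qed
    then show ?thesis
      using X(1) by (auto simp: A_def)
  qed
  obtain x where x: "longest p x"
  proof -
    obtain a b where ab: "longest a b" "a \<le> p"
      using longest_cover[of p] \<open>p < q\<close> by auto
    then have "p \<le> a"
      using on D' by (auto simp: longest_def strands_on_def)
    then show ?thesis
      using ab that by auto
  qed
  have bound: "y \<le> q" if "longest w y" for w y
    using that on D' by (auto simp: longest_def strands_on_def)
  \<comment> \<open>The maximal strands form a chain from \<open>p\<close> to \<open>q\<close> along which the rank increases.\<close>
  have chain: "\<exists>w. longest w q \<and> \<rho> (p, x) \<le> \<rho> (w, q)" if "longest w y" "\<rho> (p, x) \<le> \<rho> (w, y)" for w y
    using that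
  proof (induction "q - y" arbitrary: w y rule: less_induct)
    case less
    have wy: "(w, y) \<in> D" "p \<le> w" "w < y" "y \<le> q"
      using less.prems on D' by (auto simp: longest_def strands_on_def)
    show ?case
    proof (cases "y = q")
      case False
      then obtain a b where ab: "longest a b" "a \<le> y" "y < b"
        using longest_cover[of y] wy by auto
      have abD: "(a, b) \<in> D" "(a, b) \<in> D'" "b \<le> q"
        using ab D' on by (auto simp: longest_def strands_on_def)
      \<comment> \<open>A start strictly between \<open>w\<close> and \<open>y\<close> would make
        the strands cross, and a start at or before \<open>w\<close> would contradict the maximality
        of \<open>(w, y)\<close>.\<close>
      have "a = y"
      proof (rule ccontr)
        assume "a \<noteq> y"
        then have "a < y" using ab by simp
        have "\<not> w < a"
          using ranked_noncrossing[OF r wy(1) abD(1)] \<open>a < y\<close> ab(3) by blast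
        then show False
          using less.prems(1) abD(2) ab(3) by (simp add: longest_def not_less) (metis less_imp_le less_irrefl)
      qed
      have "nonorth (w, y) (y, b)"
        using wy ab by (auto simp: nonorth_def)
      then have "\<rho> (w, y) < \<rho> (y, b)"
        using ranked_less[OF r wy(1), of "(y, b)"] abD wy \<open>a = y\<close> by auto
      then show ?thesis
        using less.hyps[of b y] less.prems ab abD wy \<open>a = y\<close> by auto
    qed (use less.prems in auto)
  qed
  from chain[OF x] obtain w where w: "longest w q" "\<rho> (p, x) \<le> \<rho> (w, q)"
    by auto
  have wD: "(w, q) \<in> D" "p < w" "w < q" and xD: "(p, x) \<in> D" "x < q" "p < x"
    using w x on D' le_neq_implies_less by (auto simp: longest_def strands_on_def subset_iff) (metis le_neq_implies_less)+
  \<comment> \<open>The cycle closes through the nonzero morphisms \<open>M(w,q)\<close> to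
    \<open>M(p,q)\<close> to \<open>M(p,x)\<close>.\<close>
  have "\<rho> (w, q) < \<rho> (p, q)"
    using ranked_less[OF r wD(1) pq] wD by (auto simp: nonorth_def)
  also have "\<dots> < \<rho> (p, x)"
    using ranked_less[OF r pq xD(1)] xD by (auto simp: nonorth_def)
  finally show False
    using w by simp
qed

lemma ranked_split_inner:
  assumes r: "ranked \<rho> D" and pq: "(p, q) \<in> D" "p < q"
  shows "\<exists>m. p \<le> m \<and> m < q \<and>
    D \<inter> strands_on p q = insert (p, q) ((D \<inter> strands_on p m) \<union> (D \<inter> strands_on (Suc m) q))"
proof -
  let ?D = "D \<inter> strands_on p q"
  have "ranked \<rho> ?D" "?D \<subseteq> strands_on p q" "(p, q) \<in> ?D"
    using pq ranked_subset[OF r, of ?D] by (auto simp: strands_on_def)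
  from ranked_split[OF this]
  obtain m where m: "p \<le> m" "m < q"
    "?D = insert (p, q) ((?D \<inter> strands_on p m) \<union> (?D \<inter> strands_on (Suc m) q))"
    by (elim exE conjE) (rule that)
  have "strands_on p m \<subseteq> strands_on p q" "strands_on (Suc m) q \<subseteq> strands_on p q"
    using m(1,2) by (auto simp: strands_on_def)
  then have "?D \<inter> strands_on p m = D \<inter> strands_on p m"
    "?D \<inter> strands_on (Suc m) q = D \<inter> strands_on (Suc m) q"
    by auto
  with m(3) have "?D = insert (p, q) ((D \<inter> strands_on p m) \<union> (D \<inter> strands_on (Suc m) q))"
    by (simp only:)
  with m(1,2) show ?thesis
    by blast
qed

text \<open>A strand starting at \<open>u\<close> ends by \<open>k\<close> because \<open>k\<close>
  is maximal, and any other strand cannot cross \<open>(u, k)\<close>; hence everything lies in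
  \<open>[u,k]\<close> or \<open>[k,v]\<close>, and the part over \<open>[u,k]\<close> splits once
  more.\<close>

lemma ranked_split_right:
  assumes r: "ranked \<rho> D" and on: "D \<subseteq> strands_on u v" and k: "(u, k) \<in> D"
    and max: "\<And>k'. (u, k') \<in> D \<Longrightarrow> k' \<le> k"
  obtains m where "u \<le> m" "m < k" "k \<le> v"
    "D = insert (u, k) ((D \<inter> strands_on u m) \<union> (D \<inter> strands_on (Suc m) k) \<union> (D \<inter> strands_on k v))"
proof -
  have "u < k" "k \<le> v"
    using on k by (auto simp: strands_on_def)
  obtain m where m: "u \<le> m" "m < k" "D \<inter> strands_on u k =
    insert (u, k) ((D \<inter> strands_on u m) \<union> (D \<inter> strands_on (Suc m) k))"
    using ranked_split_inner[OF r k \<open>u < k\<close>] by auto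
  have "D \<subseteq> strands_on u k \<union> strands_on k v"
  proof (rule subrelI)
    fix i j assume ij: "(i, j) \<in> D"
    then have *: "u \<le> i" "i < j" "j \<le> v"
      using on by (auto simp: strands_on_def)
    have "\<not> (u < i \<and> i < k \<and> k < j)"
      using ranked_noncrossing[OF r k ij] by blast
    then show "(i, j) \<in> strands_on u k \<union> strands_on k v"
      using * max[of j] ij by (cases "u = i") (auto simp: strands_on_def)
  qed
  then have "D = insert (u, k) ((D \<inter> strands_on u m) \<union> (D \<inter> strands_on (Suc m) k) \<union> (D \<inter> strands_on k v))"
    using m(3) k by blast
  then show thesis
    using that m(1,2) \<open>k \<le> v\<close> by blast
qed

lemma ranked_split_left:
  assumes r: "ranked \<rho> D" and on: "D \<subseteq> strands_on u v" and k: "(k, v) \<in> D"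
    and min: "\<And>k'. (k', v) \<in> D \<Longrightarrow> k \<le> k'"
  obtains m where "u \<le> k" "k \<le> m" "m < v"
    "D = insert (k, v) ((D \<inter> strands_on (Suc m) v) \<union> (D \<inter> strands_on k m) \<union> (D \<inter> strands_on u k))"
proof -
  have "u \<le> k" "k < v"
    using on k by (auto simp: strands_on_def)
  obtain m where m: "k \<le> m" "m < v" "D \<inter> strands_on k v =
    insert (k, v) ((D \<inter> strands_on k m) \<union> (D \<inter> strands_on (Suc m) v))"
    using ranked_split_inner[OF r k \<open>k < v\<close>] by auto
  have "D \<subseteq> strands_on u k \<union> strands_on k v"
  proof (rule subrelI)
    fix i j assume ij: "(i, j) \<in> D"
    then have *: "u \<le> i" "i < j" "j \<le> v"
      using on by (auto simp: strands_on_def)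
    have "\<not> (i < k \<and> k < j \<and> j < v)"
      using ranked_noncrossing[OF r ij k] by blast
    then show "(i, j) \<in> strands_on u k \<union> strands_on k v"
      using * min[of i] ij by (cases "j = v") (auto simp: strands_on_def)
  qed
  then have "D = insert (k, v) ((D \<inter> strands_on (Suc m) v) \<union> (D \<inter> strands_on k m) \<union> (D \<inter> strands_on u k))"
    using m(3) k by blast
  then show thesis
    using that m(1,2) \<open>u \<le> k\<close> by blast
qed

section \<open>Placing trees on a vertex range, and counting strands\<close>

lemma card_insert_Un3_le:
  assumes "D = insert x (A \<union> B \<union> C)" "finite D"
  shows "card D \<le> 1 + card A + card B + card C"
proof -
  have "card D \<le> Suc (card (A \<union> B \<union> C))"
    using assms by (simp add: card_insert_if)
  moreover have "card (A \<union> B \<union> C) \<le> card (A \<union> B) + card C" "card (A \<union> B) \<le> card A + card B"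
    by (rule card_Un_le)+
  ultimately show ?thesis
    by linarith
qed

text \<open>
  A tree with \<open>N\<close> nodes attached at \<open>p\<close> occupies the vertices \<open>p, \<dots>, p + N\<close> in the case of
  \<open>place_right\<close>, and \<open>p - N, \<dots>, p\<close> in the case of \<open>place_left\<close>.  The latter is meaningful only if
  \<open>N \<le> p\<close>, because of the truncated subtraction.
\<close>

fun place_right place_left :: "nat \<Rightarrow> 'l ttree \<Rightarrow> strand ttree" where
  "place_right p Leaf = Leaf"
| "place_right p (Node x a b c) =
     (let q = p + num_nodes a + num_nodes b + 1
      in Node (p, q) (place_right p a) (place_left q b) (place_right q c))"
| "place_left q Leaf = Leaf"
| "place_left q (Node x a b c) =
     (let p = q - (num_nodes a + num_nodes b + 1)
      in Node (p, q) (place_left q a) (place_right p b) (place_left p c))"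

abbreviation right_strands :: "nat \<Rightarrow> 'l ttree \<Rightarrow> strand set" where
  "right_strands p t \<equiv> set (node_labels (place_right p t))"

abbreviation left_strands :: "nat \<Rightarrow> 'l ttree \<Rightarrow> strand set" where
  "left_strands p t \<equiv> set (node_labels (place_left p t))"

lemma place_strands_on:
  "right_strands p t \<subseteq> strands_on p (p + num_nodes t)"
  "num_nodes t \<le> p \<Longrightarrow> left_strands p t \<subseteq> strands_on (p - num_nodes t) p"
proof (induction t arbitrary: p)
  case (Node x a b c)
  {
    case 1
    show ?case
      using Node.IH(1)[of p] Node.IH(4)[of "p + num_nodes a + num_nodes b + 1"]
        Node.IH(5)[of "p + num_nodes a + num_nodes b + 1"]
      by (fastforce simp: strands_on_def Let_def)
  next
    case 2
    then show ?case
      using Node.IH(2)[of p] Node.IH(3)[of "p - (num_nodes a + num_nodes b + 1)"]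
        Node.IH(6)[of "p - (num_nodes a + num_nodes b + 1)"]
      by (fastforce simp: strands_on_def Let_def)
  }
qed simp_all

lemma num_nodes_place [simp]:
  "num_nodes (place_right p t) = num_nodes t" "num_nodes (place_left p t) = num_nodes t"
  by (induction t arbitrary: p) (simp_all add: Let_def)

lemma shape_place [simp]:
  "shape (map_ttree f (place_right p t)) = t" "shape (map_ttree f (place_left p t)) = t"
  for t :: "unit ttree"
  by (induction t arbitrary: p) (simp_all add: Let_def shape_def)

lemma length_node_labels [simp]: "length (node_labels t) = num_nodes t"
  by (induction t) simp_all

lemma num_leaves_eq: "num_leaves t = 2 * num_nodes t + 1"
  by (induction t) simp_all

lemma node_labels_map [simp]: "node_labels (map_ttree f t) = map f (node_labels t)"
  by (induction t) simp_all

lemma num_nodes_map [simp]: "num_nodes (map_ttree f t) = num_nodes t"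
  by (induction t) simp_all

text \<open>Right and left placements are treated in one induction because each contains pieces of
  the other kind. The size bound belongs to the same induction: a diagram attains it only if all
  three pieces do, and only then does the induction hypothesis supply trees for the pieces.\<close>

lemma ranked_eq_place:
  assumes "ranked \<rho> D" "D \<subseteq> strands_on u v" "u \<le> v"
  shows "card D \<le> v - u \<and> (card D = v - u \<longrightarrow>
    (\<exists>t::unit ttree. num_nodes t = v - u \<and> right_strands u t = D) \<and>
    (\<exists>t::unit ttree. num_nodes t = v - u \<and> left_strands v t = D))"
    (is "?P D u v")
  using assms
proof (induction "v - u" arbitrary: u v D rule: less_induct)
  case less
  note r = less.prems(1) and on = less.prems(2)
  have fin: "finite D"
    using finite_subset[OF on] by simp
  have onD: "u \<le> i" "i < j" "j \<le> v" if "(i, j) \<in> D" for i j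
    using subsetD[OF on that] by (simp_all add: strands_on_def)
  have IH: "?P (D \<inter> strands_on u' v') u' v'"
    if "u \<le> u'" "v' \<le> v" "u' \<le> v'" "u < u' \<or> v' < v" for u' v'
    using that less.hyps[of v' u' "D \<inter> strands_on u' v'"] less.prems(3) ranked_subset[OF r]
    by auto
  show ?case
  proof (cases "u = v")
    case True
    then have "D = {}"
      using on by (auto simp: strands_on_def)
    then show ?thesis
      using True by (auto intro!: exI[of _ Leaf])
  next
    case False
    then have "u < v"
      using less.prems(3) by simp
    have right: "card D \<le> v - u \<and> (card D = v - u \<longrightarrow>
      (\<exists>t::unit ttree. num_nodes t = v - u \<and> right_strands u t = D))"
    proof (cases "\<exists>k. (u, k) \<in> D")
      case False
      have "u < i" if "(i, j) \<in> D" for i j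
        using False that onD[OF that] le_neq_implies_less by blast
      \<comment> \<open>Without a strand at \<open>u\<close> the range shrinks by one step, so the
        bound is strict and the equality case is void.\<close>
      then have "D \<subseteq> strands_on (Suc u) v"
        using onD by (intro subrelI) (simp add: strands_on_def Suc_le_eq)
      then have "D \<inter> strands_on (Suc u) v = D"
        by blast
      then show ?thesis
        using IH[of "Suc u" v] \<open>u < v\<close> by auto
    next
      case True
      define k where "k = Max {k. (u, k) \<in> D}"
      have fink: "finite {k. (u, k) \<in> D}"
        by (rule finite_subset[of _ "snd ` D"]) (use fin in force)+
      have k: "(u, k) \<in> D" "\<And>k'. (u, k') \<in> D \<Longrightarrow> k' \<le> k"
        using Max_in[OF fink] Max_ge[OF fink] True by (auto simp: k_def)
      obtain m where m: "u \<le> m" "m < k" "k \<le> v" and D: "D = insert (u, k)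
          ((D \<inter> strands_on u m) \<union> (D \<inter> strands_on (Suc m) k) \<union> (D \<inter> strands_on k v))"
        using ranked_split_right[OF r on k] by blast
      have le: "card D \<le> 1 + card (D \<inter> strands_on u m) + card (D \<inter> strands_on (Suc m) k) + card (D \<inter> strands_on k v)"
        using card_insert_Un3_le[OF D fin] .
      have P: "?P (D \<inter> strands_on u m) u m" "?P (D \<inter> strands_on (Suc m) k) (Suc m) k"
          "?P (D \<inter> strands_on k v) k v"
        using m by (intro IH; simp)+
      have "card D \<le> v - u"
        using le P m by linarith
      moreover have "\<exists>t::unit ttree. num_nodes t = v - u \<and> right_strands u t = D" if "card D = v - u"
      proof -
        \<comment> \<open>The three upper bounds and the splitting strand sum to
          \<open>v - u\<close>, so equality in the total forces equality in each.\<close>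
        have "card (D \<inter> strands_on u m) = m - u" "card (D \<inter> strands_on (Suc m) k) = k - Suc m"
          "card (D \<inter> strands_on k v) = v - k"
          using le P that m by linarith+
        then obtain a b c :: "unit ttree" where abc:
          "num_nodes a = m - u" "right_strands u a = D \<inter> strands_on u m"
          "num_nodes b = k - Suc m" "left_strands k b = D \<inter> strands_on (Suc m) k"
          "num_nodes c = v - k" "right_strands k c = D \<inter> strands_on k v"
          using P by metis
        have *: "u + num_nodes a + num_nodes b + 1 = k"
          using abc m by simp
        have "right_strands u (Node () a b c) = D"
          by (rule trans[OF _ D[symmetric]]) (simp only: place_right.simps Let_def * node_labels.simps set_simps set_append abc(2,4,6) Un_assoc)
        moreover have "num_nodes (Node () a b c) = v - u"
          using abc m by simp
        ultimately show ?thesis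
          by blast
      qed
      ultimately show ?thesis
        by blast
    qed
    \<comment> \<open>Only the existence of a tree remains on this side; the bound is already
      contained in \<open>right\<close>.\<close>
    have left: "\<exists>t::unit ttree. num_nodes t = v - u \<and> left_strands v t = D" if card: "card D = v - u"
    proof (cases "\<exists>k. (k, v) \<in> D")
      case False
      have "j < v" if "(i, j) \<in> D" for i j
        using False that onD[OF that] le_neq_implies_less by blast
      then have "D \<subseteq> strands_on u (v - 1)"
        using onD by (intro subrelI) (fastforce simp add: strands_on_def)
      then have "D \<inter> strands_on u (v - 1) = D"
        by blast
      then show ?thesis
        using IH[of u "v - 1"] \<open>u < v\<close> card by (cases v) auto
    next
      case True
      define k where "k = Min {k. (k, v) \<in> D}"
      have fink: "finite {k. (k, v) \<in> D}"
        by (rule finite_subset[of _ "fst ` D"]) (use fin in force)+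
      have k: "(k, v) \<in> D" "\<And>k'. (k', v) \<in> D \<Longrightarrow> k \<le> k'"
        using Min_in[OF fink] Min_le[OF fink] True by (auto simp: k_def)
      obtain m where m: "u \<le> k" "k \<le> m" "m < v" and D: "D = insert (k, v)
          ((D \<inter> strands_on (Suc m) v) \<union> (D \<inter> strands_on k m) \<union> (D \<inter> strands_on u k))"
        using ranked_split_left[OF r on k] by blast
      have le: "card D \<le> 1 + card (D \<inter> strands_on (Suc m) v) + card (D \<inter> strands_on k m) + card (D \<inter> strands_on u k)"
        using card_insert_Un3_le[OF D fin] .
      have P: "?P (D \<inter> strands_on (Suc m) v) (Suc m) v" "?P (D \<inter> strands_on k m) k m"
          "?P (D \<inter> strands_on u k) u k"
        using m by (intro IH; simp)+
      have "card (D \<inter> strands_on (Suc m) v) = v - Suc m" "card (D \<inter> strands_on k m) = m - k"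
        "card (D \<inter> strands_on u k) = k - u"
        using le P card m by linarith+
      then obtain a b c :: "unit ttree" where abc:
        "num_nodes a = v - Suc m" "left_strands v a = D \<inter> strands_on (Suc m) v"
        "num_nodes b = m - k" "right_strands k b = D \<inter> strands_on k m"
        "num_nodes c = k - u" "left_strands k c = D \<inter> strands_on u k"
        using P by metis
      have *: "v - (num_nodes a + num_nodes b + 1) = k"
        using abc m by simp
      have "left_strands v (Node () a b c) = D"
        by (rule trans[OF _ D[symmetric]]) (simp only: place_left.simps Let_def * node_labels.simps set_simps set_append abc(2,4,6) Un_assoc)
      moreover have "num_nodes (Node () a b c) = v - u"
        using abc m by simp
      ultimately show ?thesis
        by blast
    qed
    from right left show ?thesis
      by blast
  qed
qed

lemma place_bounds:
  "(x, y) \<in> right_strands p t \<Longrightarrow> p \<le> x \<and> x < y \<and> y \<le> p + num_nodes t"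
  "(x, y) \<in> left_strands p t \<Longrightarrow> num_nodes t \<le> p \<Longrightarrow> p - num_nodes t \<le> x \<and> x < y \<and> y \<le> p"
  using place_strands_on[where p = p and t = t] by (auto simp: strands_on_def)

section \<open>Placed trees yield exceptional sequences\<close>

lemma exc_list_append:
  "exc_list (xs @ ys) \<longleftrightarrow> exc_list xs \<and> exc_list ys \<and> (\<forall>X\<in>set xs. \<forall>Y\<in>set ys. \<not> nonorth Y X)"
  by (auto simp: exc_list_def sorted_wrt_append)

lemma exc_list_Cons:
  "exc_list (X # xs) \<longleftrightarrow> exc_list xs \<and> (\<forall>Y\<in>set xs. \<not> nonorth Y X)"
  by (auto simp: exc_list_def)

lemma exc_list_Nil: "exc_list []"
  by (simp add: exc_list_def)

text \<open>The order is dictated by the relations at the root strand. In a right placement the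
  strands of \<open>b\<close> may map to the root, the root may map to strands of \<open>a\<close>,
  and the root may have extensions by strands of \<open>c\<close>, whence \<open>b\<close>, root,
  \<open>a\<close>, \<open>c\<close>. In a left placement the strands of \<open>a\<close> may map to
  the root, those of \<open>c\<close> may have extensions by it, and it may map to strands of
  \<open>b\<close>, whence \<open>a\<close>, \<open>c\<close>, root, \<open>b\<close>.\<close>

lemma place_exc_list:
  "\<exists>xs. set xs = right_strands p t \<and> length xs = num_nodes t \<and> exc_list xs"
  "num_nodes t \<le> p \<Longrightarrow> \<exists>xs. set xs = left_strands p t \<and> length xs = num_nodes t \<and> exc_list xs"
proof (induction t arbitrary: p)
  case (Node z a b c)
  {
    case 1
    define q where "q = p + num_nodes a + num_nodes b + 1"
    obtain as bs cs where
      as: "set as = right_strands p a" "length as = num_nodes a" "exc_list as" and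
      bs: "set bs = left_strands q b" "length bs = num_nodes b" "exc_list bs" and
      cs: "set cs = right_strands q c" "length cs = num_nodes c" "exc_list cs"
      using Node.IH(1)[of p] Node.IH(4)[of q] Node.IH(5)[of q] by (auto simp: q_def)
    have A: "p \<le> x \<and> x < y \<and> y \<le> p + num_nodes a" if "(x, y) \<in> set as" for x y
      using that as place_bounds by metis
    have B: "p + num_nodes a < x \<and> x < y \<and> y \<le> q" if "(x, y) \<in> set bs" for x y
      using that bs place_bounds(2)[of x y q b] by (auto simp: q_def)
    have C: "q \<le> x \<and> x < y" if "(x, y) \<in> set cs" for x y
      using that cs place_bounds(1)[of x y q c] by auto
    have "exc_list (bs @ (p, q) # as @ cs)"
      unfolding exc_list_append exc_list_Cons
      using as(3) bs(3) cs(3) by (auto simp: nonorth_def dest!: A B C) (auto simp: q_def)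
    moreover have "set (bs @ (p, q) # as @ cs) = right_strands p (Node z a b c)"
      using as bs cs by (auto simp: q_def Let_def)
    ultimately show ?case
      using as bs cs by (intro exI[of _ "bs @ (p, q) # as @ cs"]) auto
  next
    case 2
    define q where "q = p - (num_nodes a + num_nodes b + 1)"
    have qp: "p = q + num_nodes a + num_nodes b + 1"
      using 2 by (simp add: q_def)
    have le: "num_nodes a \<le> p" "num_nodes c \<le> q"
      using 2 by (simp_all add: qp)
    obtain as bs cs where
      as: "set as = left_strands p a" "length as = num_nodes a" "exc_list as" and
      bs: "set bs = right_strands q b" "length bs = num_nodes b" "exc_list bs" and
      cs: "set cs = left_strands q c" "length cs = num_nodes c" "exc_list cs"
      using Node.IH(2)[of p] Node.IH(3)[of q] Node.IH(6)[of q] le by auto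
    have A: "q + num_nodes b < x \<and> x < y \<and> y \<le> p" if "(x, y) \<in> set as" for x y
      using that as place_bounds(2)[of x y p a] by (auto simp: qp)
    have B: "q \<le> x \<and> x < y \<and> y \<le> q + num_nodes b" if "(x, y) \<in> set bs" for x y
      using that bs place_bounds(1)[of x y q b] by auto
    have C: "x < y \<and> y \<le> q" if "(x, y) \<in> set cs" for x y
      using that cs place_bounds(2)[of x y q c] 2 by (auto simp: qp)
    have "exc_list (as @ cs @ (q, p) # bs)"
      unfolding exc_list_append exc_list_Cons
      using as(3) bs(3) cs(3) by (auto simp: nonorth_def dest!: A B C) (auto simp: qp)
    moreover have "set (as @ cs @ (q, p) # bs) = left_strands p (Node z a b c)"
      using as bs cs by (auto simp: q_def Let_def)
    ultimately show ?case
      using as bs cs by (intro exI[of _ "as @ cs @ (q, p) # bs"]) auto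
  }
qed (auto simp: exc_list_Nil)

section \<open>Directing the diagram away from the root\<close>

text \<open>The edges of the placed diagrams, directed away from the root.\<close>

fun arcs_right arcs_left :: "nat \<Rightarrow> 'l ttree \<Rightarrow> (nat \<times> nat) set" where
  "arcs_right p Leaf = {}"
| "arcs_right p (Node x a b c) =
     (let q = p + num_nodes a + num_nodes b + 1
      in insert (p, q) (arcs_right p a \<union> arcs_left q b \<union> arcs_right q c))"
| "arcs_left q Leaf = {}"
| "arcs_left q (Node x a b c) =
     (let p = q - (num_nodes a + num_nodes b + 1)
      in insert (q, p) (arcs_left q a \<union> arcs_right p b \<union> arcs_left p c))"

lemma strands_iff_arcs:
  "(i, j) \<in> right_strands p t \<longleftrightarrow> i < j \<and> ((i, j) \<in> arcs_right p t \<or> (j, i) \<in> arcs_right p t)"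
  "num_nodes t \<le> p \<Longrightarrow>
    (i, j) \<in> left_strands p t \<longleftrightarrow> i < j \<and> ((i, j) \<in> arcs_left p t \<or> (j, i) \<in> arcs_left p t)"
proof (induction t arbitrary: p)
  case (Node x a b c)
  {
    case 1
    show ?case
      using Node.IH(1)[of p] Node.IH(4)[of "p + num_nodes a + num_nodes b + 1"]
        Node.IH(5)[of "p + num_nodes a + num_nodes b + 1"]
      by (auto simp: Let_def)
  next
    case 2
    then show ?case
      using Node.IH(2)[of p] Node.IH(3)[of "p - (num_nodes a + num_nodes b + 1)"]
        Node.IH(6)[of "p - (num_nodes a + num_nodes b + 1)"]
      by (auto simp: Let_def)
  }
qed simp_all

lemma arcs_bounds:
  "(x, y) \<in> arcs_right p t \<Longrightarrow>
    p \<le> x \<and> x \<le> p + num_nodes t \<and> p < y \<and> y \<le> p + num_nodes t \<and> x \<noteq> y"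
  "(x, y) \<in> arcs_left p t \<Longrightarrow> num_nodes t \<le> p \<Longrightarrow>
    p - num_nodes t \<le> x \<and> x \<le> p \<and> p - num_nodes t \<le> y \<and> y < p \<and> x \<noteq> y"
proof (induction t arbitrary: p)
  case (Node z a b c)
  {
    case 1
    then show ?case
      using Node.IH(1)[of p] Node.IH(4)[of "p + num_nodes a + num_nodes b + 1"]
        Node.IH(5)[of "p + num_nodes a + num_nodes b + 1"]
      by (auto simp: Let_def)
  next
    case 2
    then have "num_nodes c \<le> p - (num_nodes a + num_nodes b + 1)"
      by simp
    with 2 show ?case
      using Node.IH(2)[of p] Node.IH(3)[of "p - (num_nodes a + num_nodes b + 1)"]
        Node.IH(6)[of "p - (num_nodes a + num_nodes b + 1)"]
      by (auto simp: Let_def)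
  }
qed simp_all

text \<open>No arc enters the attaching vertex of its own subtree. The heads of the arcs of
  \<open>a\<close>, \<open>b\<close>, \<open>c\<close> therefore lie in disjoint ranges that also
  avoid \<open>q\<close>, so the position of \<open>z\<close> decides which subtree an arc into
  \<open>z\<close> belongs to.\<close>

lemma arcs_parent_unique:
  "(x, z) \<in> arcs_right p t \<Longrightarrow> (y, z) \<in> arcs_right p t \<Longrightarrow> x = y"
  "num_nodes t \<le> p \<Longrightarrow> (x, z) \<in> arcs_left p t \<Longrightarrow> (y, z) \<in> arcs_left p t \<Longrightarrow> x = y"
proof (induction t arbitrary: p)
  case (Node l a b c)
  {
    case 1
    define q where "q = p + num_nodes a + num_nodes b + 1"
    have E: "arcs_right p (Node l a b c) = insert (p, q) (arcs_right p a \<union> arcs_left q b \<union> arcs_right q c)"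
      by (simp add: q_def Let_def)
    have A: "z \<le> p + num_nodes a" if "(w, z) \<in> arcs_right p a" for w
      using arcs_bounds(1)[OF that] by simp
    have B: "p + num_nodes a < z \<and> z < q" if "(w, z) \<in> arcs_left q b" for w
      using arcs_bounds(2)[OF that] by (simp add: q_def)
    have C: "q < z" if "(w, z) \<in> arcs_right q c" for w
      using arcs_bounds(1)[OF that] by simp
    have q: "p + num_nodes a < q" "num_nodes b \<le> q"
      by (simp_all add: q_def)
    have D: "(w, z) = (p, q) \<or> (w, z) \<in> arcs_right p a \<or> (w, z) \<in> arcs_left q b \<or> (w, z) \<in> arcs_right q c"
      if "(w, z) \<in> arcs_right p (Node l a b c)" for w
      using that unfolding E by blast
    consider "z \<le> p + num_nodes a" | "p + num_nodes a < z" "z < q" | "z = q" | "q < z"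
      by linarith
    then show ?case
    proof cases
      case z: 1
      have "(w, z) \<in> arcs_right p a" if "(w, z) \<in> arcs_right p (Node l a b c)" for w
        using D[OF that] B[of w] C[of w] z q(1) by auto
      then show ?thesis
        using 1 Node.IH(1) by blast
    next
      case z: 2
      have "(w, z) \<in> arcs_left q b" if "(w, z) \<in> arcs_right p (Node l a b c)" for w
        using D[OF that] A[of w] C[of w] z q(1) by auto
      then show ?thesis
        using 1 Node.IH(4)[OF q(2)] by blast
    next
      case z: 3
      have "w = p" if "(w, z) \<in> arcs_right p (Node l a b c)" for w
        using D[OF that] A[of w] B[of w] C[of w] z q(1) by auto
      then show ?thesis
        using 1 by blast
    next
      case z: 4
      have "(w, z) \<in> arcs_right q c" if "(w, z) \<in> arcs_right p (Node l a b c)" for w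
        using D[OF that] A[of w] B[of w] z q(1) by auto
      then show ?thesis
        using 1 Node.IH(5) by blast
    qed
  next
    case 2
    define q where "q = p - (num_nodes a + num_nodes b + 1)"
    have qp: "p = q + num_nodes a + num_nodes b + 1"
      using 2 by (simp add: q_def)
    have E: "arcs_left p (Node l a b c) = insert (p, q) (arcs_left p a \<union> arcs_right q b \<union> arcs_left q c)"
      by (simp add: q_def Let_def)
    have q: "num_nodes a \<le> p" "num_nodes c \<le> q"
      using 2 by (simp_all add: qp)
    have A: "q + num_nodes b < z" if "(w, z) \<in> arcs_left p a" for w
      using arcs_bounds(2)[OF that] by (simp add: qp)
    have B: "q < z \<and> z \<le> q + num_nodes b" if "(w, z) \<in> arcs_right q b" for w
      using arcs_bounds(1)[OF that] by simp
    have C: "z < q" if "(w, z) \<in> arcs_left q c" for w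
      using arcs_bounds(2)[OF that q(2)] by simp
    have D: "(w, z) = (p, q) \<or> (w, z) \<in> arcs_left p a \<or> (w, z) \<in> arcs_right q b \<or> (w, z) \<in> arcs_left q c"
      if "(w, z) \<in> arcs_left p (Node l a b c)" for w
      using that unfolding E by blast
    consider "q + num_nodes b < z" | "q < z" "z \<le> q + num_nodes b" | "z = q" | "z < q"
      by linarith
    then show ?case
    proof cases
      case z: 1
      have "(w, z) \<in> arcs_left p a" if "(w, z) \<in> arcs_left p (Node l a b c)" for w
        using D[OF that] B[of w] C[of w] z by auto
      then show ?thesis
        using 2 Node.IH(2)[OF q(1)] by blast
    next
      case z: 2
      have "(w, z) \<in> arcs_right q b" if "(w, z) \<in> arcs_left p (Node l a b c)" for w
        using D[OF that] A[of w] C[of w] z by auto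
      then show ?thesis
        using 2 Node.IH(3) by blast
    next
      case z: 3
      have "w = p" if "(w, z) \<in> arcs_left p (Node l a b c)" for w
        using D[OF that] A[of w] B[of w] C[of w] z by auto
      then show ?thesis
        using 2 by blast
    next
      case z: 4
      have "(w, z) \<in> arcs_left q c" if "(w, z) \<in> arcs_left p (Node l a b c)" for w
        using D[OF that] A[of w] B[of w] z by auto
      then show ?thesis
        using 2 Node.IH(6)[OF q(2)] by blast
    qed
  }
qed simp_all

lemma arcs_reach:
  "(x, y) \<in> arcs_right p t \<Longrightarrow> (p, x) \<in> (arcs_right p t)\<^sup>*"
  "(x, y) \<in> arcs_left p t \<Longrightarrow> (p, x) \<in> (arcs_left p t)\<^sup>*"
proof (induction t arbitrary: p)
  case (Node l a b c)
  {
    case 1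
    define q where "q = p + num_nodes a + num_nodes b + 1"
    have E: "arcs_right p (Node l a b c) = insert (p, q) (arcs_right p a \<union> arcs_left q b \<union> arcs_right q c)"
      by (simp add: q_def Let_def)
    have "(arcs_right p a)\<^sup>* \<subseteq> (arcs_right p (Node l a b c))\<^sup>*"
      "(arcs_left q b)\<^sup>* \<subseteq> (arcs_right p (Node l a b c))\<^sup>*"
      "(arcs_right q c)\<^sup>* \<subseteq> (arcs_right p (Node l a b c))\<^sup>*"
      unfolding E by (intro rtrancl_mono; blast)+
    moreover have "(p, q) \<in> arcs_right p (Node l a b c)"
      unfolding E by simp
    moreover have "(x, y) = (p, q) \<or> (x, y) \<in> arcs_right p a \<or> (x, y) \<in> arcs_left q b \<or> (x, y) \<in> arcs_right q c"
      using 1 unfolding E by blast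
    ultimately show ?case
      using Node.IH(1)[of p] Node.IH(4)[of q] Node.IH(5)[of q]
      by (blast intro: converse_rtrancl_into_rtrancl)
  next
    case 2
    define q where "q = p - (num_nodes a + num_nodes b + 1)"
    have E: "arcs_left p (Node l a b c) = insert (p, q) (arcs_left p a \<union> arcs_right q b \<union> arcs_left q c)"
      by (simp add: q_def Let_def)
    have "(arcs_left p a)\<^sup>* \<subseteq> (arcs_left p (Node l a b c))\<^sup>*"
      "(arcs_right q b)\<^sup>* \<subseteq> (arcs_left p (Node l a b c))\<^sup>*"
      "(arcs_left q c)\<^sup>* \<subseteq> (arcs_left p (Node l a b c))\<^sup>*"
      unfolding E by (intro rtrancl_mono; blast)+
    moreover have "(p, q) \<in> arcs_left p (Node l a b c)"
      unfolding E by simp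
    moreover have "(x, y) = (p, q) \<or> (x, y) \<in> arcs_left p a \<or> (x, y) \<in> arcs_right q b \<or> (x, y) \<in> arcs_left q c"
      using 2 unfolding E by blast
    ultimately show ?case
      using Node.IH(2)[of p] Node.IH(3)[of q] Node.IH(6)[of q]
      by (blast intro: converse_rtrancl_into_rtrancl)
  }
qed simp_all

text \<open>An undirected diagram \<open>D\<close> together with a direction \<open>E\<close> of its
  edges away from 0. Its purpose is to evaluate the definite description in
  \<open>oriented_right\<close>, by identifying simple paths from 0 with directed ones.\<close>

locale directed_diagram =
  fixes D :: "strand set" and E :: "(nat \<times> nat) set"
  assumes parent_unique: "(x, z) \<in> E \<Longrightarrow> (y, z) \<in> E \<Longrightarrow> x = y"
    and root_no_parent: "(x, 0) \<notin> E"
    and edge_iff: "(x, y) \<in> D \<or> (y, x) \<in> D \<longleftrightarrow> (x, y) \<in> E \<or> (y, x) \<in> E"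
    and reach: "(x, y) \<in> E \<Longrightarrow> (0, x) \<in> E\<^sup>*"
begin

definition directed_path :: "nat \<Rightarrow> nat list \<Rightarrow> bool" where
  "directed_path v q \<longleftrightarrow> q \<noteq> [] \<and> hd q = 0 \<and> last q = v \<and> successively (\<lambda>x y. (x, y) \<in> E) q"

lemma directed_path_snoc:
  "directed_path v (q @ [w]) \<longleftrightarrow> w = v \<and> (if q = [] then v = 0 else directed_path (last q) q \<and> (last q, v) \<in> E)"
  by (auto simp: directed_path_def successively_append_iff)

text \<open>Read backwards from \<open>v\<close>, each predecessor is forced by
  \<open>parent_unique\<close>, and both paths must stop at 0 because 0 has no parent.\<close>

lemma directed_path_unique: "directed_path v q \<Longrightarrow> directed_path v r \<Longrightarrow> q = r"
proof (induction q arbitrary: v r rule: rev_induct)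
  case Nil
  then show ?case by (simp add: directed_path_def)
next
  case (snoc w q)
  then obtain r' w' where r: "r = r' @ [w']"
    by (cases r rule: rev_cases) (auto simp: directed_path_def)
  show ?case
    using snoc.prems snoc.IH[of "last q" r'] root_no_parent parent_unique[of "last q" v "last r'"]
    unfolding r directed_path_snoc by (auto split: if_splits)
qed

text \<open>If the last vertex occurred earlier, the prefix ending at that occurrence would be a
  second directed path to it.\<close>

lemma directed_path_distinct: "directed_path v q \<Longrightarrow> distinct q"
proof (induction q arbitrary: v rule: rev_induct)
  case (snoc w q)
  have "w \<notin> set q"
  proof
    assume "w \<in> set q"
    then obtain q1 q2 where q: "q = q1 @ w # q2"
      by (auto simp: in_set_conv_decomp)
    have "w = v"
      using snoc.prems by (simp add: directed_path_snoc)
    then have "directed_path w ((q1 @ [w]) @ q2 @ [w])"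
      using snoc.prems q by simp
    then have "directed_path w (q1 @ [w])"
      by (auto simp: directed_path_def successively_append_iff hd_append)
    from directed_path_unique[OF this \<open>directed_path w ((q1 @ [w]) @ q2 @ [w])\<close>]
    show False
      by simp
  qed
  then show ?case
    using snoc by (auto simp: directed_path_snoc split: if_splits)
qed simp

text \<open>The prefix up to \<open>y\<close> is directed by induction. A step against an arc would
  lead from \<open>y\<close> to its parent; but \<open>y\<close> is either 0, without a parent, or
  was reached from its parent, which would then be repeated.\<close>

lemma simple_path_imp_directed: "simple_path D 0 v q \<Longrightarrow> directed_path v q"
proof (induction q arbitrary: v rule: rev_induct)
  case (snoc w q)
  show ?case
  proof (cases q rule: rev_cases)
    case Nil
    then show ?thesis
      using snoc.prems by (auto simp: simple_path_def directed_path_def)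
  next
    case (snoc q' y)
    have "simple_path D 0 y q"
      using snoc.prems snoc by (auto simp: simple_path_def successively_append_iff hd_append)
    then have q: "directed_path y q"
      by (rule snoc.IH)
    have "(y, w) \<in> E \<or> (w, y) \<in> E"
      using snoc.prems snoc edge_iff[of y w] by (auto simp: simple_path_def successively_append_iff)
    moreover have "(w, y) \<notin> E"
    proof
      assume wy: "(w, y) \<in> E"
      show False
      proof (cases q' rule: rev_cases)
        case Nil
        then show ?thesis
          using wy q snoc root_no_parent by (auto simp: directed_path_def)
      next
        case (snoc q'' x)
        then have "(x, y) \<in> E"
          using q \<open>q = q' @ [y]\<close> by (simp add: directed_path_def successively_append_iff)
        then have "x = w"
          using wy parent_unique by blast
        then show ?thesis
          using snoc \<open>q = q' @ [y]\<close> snoc.prems by (auto simp: simple_path_def)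
      qed
    qed
    moreover have "w = v" "q \<noteq> []" "last q = y"
      using snoc.prems snoc by (simp_all add: simple_path_def)
    ultimately show ?thesis
      using q by (simp add: directed_path_snoc)
  qed
qed (simp add: simple_path_def)

lemma the_simple_path:
  assumes "directed_path v q"
  shows "(THE p. simple_path D 0 v p) = q"
proof (rule the_equality)
  have "successively (\<lambda>x y. (x, y) \<in> D \<or> (y, x) \<in> D) q"
    using assms edge_iff by (auto simp: directed_path_def elim!: successively_mono)
  then show "simple_path D 0 v q"
    using assms directed_path_distinct[OF assms] by (simp add: simple_path_def directed_path_def)
  show "p = q" if "simple_path D 0 v p" for p
    using directed_path_unique[OF simple_path_imp_directed[OF that] assms] .
qed

lemma directed_path_exists: "(0, v) \<in> E\<^sup>* \<Longrightarrow> \<exists>q. directed_path v q"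
proof (induction rule: rtrancl_induct)
  case base
  show ?case by (intro exI[of _ "[0]"]) (simp add: directed_path_def)
next
  case (step y z)
  then obtain q where "directed_path y q" by blast
  then have "directed_path z (q @ [z])"
    using step.hyps by (auto simp: directed_path_snoc) (auto simp: directed_path_def)
  then show ?case by blast
qed

text \<open>The path to \<open>y\<close> is the path to \<open>x\<close> extended by
  \<open>y\<close>: it passes through \<open>x\<close>, whereas the path to \<open>x\<close> avoids
  \<open>y\<close>. The second claim serves arcs pointing left, whose strand is written with the
  smaller endpoint \<open>y\<close> first.\<close>

lemma oriented:
  assumes "(x, y) \<in> E"
  shows "oriented_right D (x, y)" and "\<not> oriented_right D (y, x)"
proof -
  obtain q where q: "directed_path x q"
    using directed_path_exists[OF reach[OF assms]] by blast
  then have q': "directed_path y (q @ [y])"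
    using assms by (auto simp: directed_path_snoc) (auto simp: directed_path_def)
  show "oriented_right D (x, y)"
    using q by (auto simp: oriented_right_def the_simple_path[OF q'] directed_path_def)
  show "\<not> oriented_right D (y, x)"
    using directed_path_distinct[OF q'] by (simp add: oriented_right_def the_simple_path[OF q])
qed

end

section \<open>The children prescribed by a diagram are the subtrees of the placed tree\<close>

fun root_of :: "'l ttree \<Rightarrow> 'l option" where
  "root_of Leaf = None"
| "root_of (Node x a b c) = Some x"

text \<open>Expresses the root of a placed subtree as a selection from its strands, in the form in
  which \<open>child_a\<close>, \<open>child_c\<close> and \<open>root_strand\<close> make
  theirs.\<close>

lemma root_of_place_right:
  "root_of (place_right p t) =
    (if {x. (p, x) \<in> right_strands p t} = {} then None else Some (p, Max {x. (p, x) \<in> right_strands p t}))"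
proof (cases t)
  case (Node l a b c)
  define q where "q = p + num_nodes a + num_nodes b + 1"
  have "x \<le> q" if "(p, x) \<in> right_strands p t" for x
    using that place_bounds(1)[of p x p a] place_bounds(2)[of p x q b] place_bounds(1)[of p x q c]
    by (auto simp: Node Let_def q_def)
  moreover have "(p, q) \<in> right_strands p t"
    by (simp add: Node Let_def q_def)
  ultimately have "Max {x. (p, x) \<in> right_strands p t} = q" "{x. (p, x) \<in> right_strands p t} \<noteq> {}"
    by (auto intro!: Max_eqI finite_subset[of _ "{..q}"])
  then show ?thesis
    by (simp add: Node Let_def q_def)
qed simp

lemma root_of_place_left:
  assumes "num_nodes t \<le> p"
  shows "root_of (place_left p t) =
    (if {x. (x, p) \<in> left_strands p t} = {} then None else Some (Min {x. (x, p) \<in> left_strands p t}, p))"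
proof (cases t)
  case (Node l a b c)
  define q where "q = p - (num_nodes a + num_nodes b + 1)"
  have "num_nodes c \<le> q" "q < p"
    using assms by (simp_all add: Node q_def)
  then have "q \<le> x" if "(x, p) \<in> left_strands p t" for x
    using that place_bounds(2)[of x p p a] place_bounds(1)[of x p q b] place_bounds(2)[of x p q c] assms
    by (auto simp: Node Let_def q_def)
  moreover have "(q, p) \<in> left_strands p t"
    by (simp add: Node Let_def q_def)
  moreover have "finite {x. (x, p) \<in> left_strands p t}"
    by (rule finite_subset[of _ "{..p}"]) (use place_bounds(2)[of _ p p t] assms in \<open>auto simp: less_imp_le\<close>)
  ultimately have "Min {x. (x, p) \<in> left_strands p t} = q" "{x. (x, p) \<in> left_strands p t} \<noteq> {}"
    by (auto intro!: Min_eqI)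
  then show ?thesis
    by (simp add: Node Let_def q_def)
qed simp

text \<open>Strictness makes the maximiser unique, so the choice made by \<open>ARG_MAX\<close> is
  determined.\<close>

lemma longest_eqI:
  assumes "X \<in> A" "\<And>Y. Y \<in> A \<Longrightarrow> Y \<noteq> X \<Longrightarrow> snd Y - fst Y < snd X - fst X"
  shows "longest A = Some X"
proof -
  define f :: "strand \<Rightarrow> nat" where "f = (\<lambda>(i, j). j - i)"
  have f: "f Y < f X" if "Y \<in> A" "Y \<noteq> X" for Y
    using assms(2)[OF that] by (simp add: f_def case_prod_beta)
  have "(ARG_MAX f Y. Y \<in> A) \<in> A"
    by (rule arg_max_natI[of _ X _ "Suc (f X)"]) (use assms(1) f in \<open>auto simp: less_Suc_eq\<close>)
  moreover have "f (ARG_MAX f Y. Y \<in> A) = f X"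
    by (rule arg_max_equality) (use assms(1) f in \<open>auto simp: le_less\<close>)
  ultimately have "(ARG_MAX f Y. Y \<in> A) = X"
    using f by fastforce
  then show ?thesis
    using assms(1) unfolding longest_def f_def by auto
qed

lemma longest_same_end:
  assumes "\<And>y. y \<in> A \<Longrightarrow> y < j"
  shows "longest {(y, j) | y. y \<in> A} = (if A = {} then None else Some (Min A, j))"
proof (cases "A = {}")
  case False
  have "finite A"
    by (rule finite_subset[of _ "{..<j}"]) (use assms in auto)
  then have min: "Min A \<in> A" "\<And>y. y \<in> A \<Longrightarrow> Min A \<le> y"
    using False by simp_all
  have less: "j - y < j - Min A" if "y \<in> A" "y \<noteq> Min A" for y
    using min(2)[OF that(1)] assms[OF that(1)] that(2) by linarith
  then have "longest {(y, j) | y. y \<in> A} = Some (Min A, j)"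
    using min(1) by (intro longest_eqI) (auto intro!: less)
  then show ?thesis
    using False by simp
qed (simp add: longest_def)

lemma longest_same_start:
  assumes "\<And>y. y \<in> A \<Longrightarrow> i < y" "finite A"
  shows "longest {(i, y) | y. y \<in> A} = (if A = {} then None else Some (i, Max A))"
proof (cases "A = {}")
  case False
  then have max: "Max A \<in> A" "\<And>y. y \<in> A \<Longrightarrow> y \<le> Max A"
    using assms by simp_all
  have less: "y - i < Max A - i" if "y \<in> A" "y \<noteq> Max A" for y
    using max(2)[OF that(1)] assms(1)[OF that(1)] that(2) by linarith
  then have "longest {(i, y) | y. y \<in> A} = Some (i, Max A)"
    using max(1) by (intro longest_eqI) (auto intro!: less)
  then show ?thesis
    using False by simp
qed (simp add: longest_def)

text \<open>The last hypothesis on \<open>D\<close> is locality: a strand of the whole diagram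
  touching the subtree's range away from \<open>p\<close> belongs to the subtree. The vertex
  \<open>p\<close> itself must be left out of the interval, since the parent strand and sibling
  subtrees may meet it as well.\<close>

lemma grows_place:
  assumes R: "\<And>i j. (i, j) \<in> E \<Longrightarrow> oriented_right D (i, j)"
    and L: "\<And>i j. (j, i) \<in> E \<Longrightarrow> \<not> oriented_right D (i, j)"
  shows "arcs_right p t \<subseteq> E \<Longrightarrow> right_strands p t \<subseteq> D \<Longrightarrow>
      (\<And>x y. (x, y) \<in> D \<Longrightarrow> x \<in> {p<..p + num_nodes t} \<or> y \<in> {p<..p + num_nodes t}
        \<Longrightarrow> (x, y) \<in> right_strands p t) \<Longrightarrow>
      grows D (root_of (place_right p t)) (place_right p t)"
    and "num_nodes t \<le> p \<Longrightarrow> arcs_left p t \<subseteq> E \<Longrightarrow> left_strands p t \<subseteq> D \<Longrightarrow>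
      (\<And>x y. (x, y) \<in> D \<Longrightarrow> x \<in> {p - num_nodes t..<p} \<or> y \<in> {p - num_nodes t..<p}
        \<Longrightarrow> (x, y) \<in> left_strands p t) \<Longrightarrow>
      grows D (root_of (place_left p t)) (place_left p t)"
proof (induction t arbitrary: p)
  case Leaf
  {
    case 1
    show ?case by (simp add: grows.leaf)
  next
    case 2
    show ?case by (simp add: grows.leaf)
  }
next
  case (Node l a b c)
  {
    case 1
    let ?t = "Node l a b c"
    define q where "q = p + num_nodes a + num_nodes b + 1"
    have place: "place_right p ?t = Node (p, q) (place_right p a) (place_left q b) (place_right q c)"
      and T: "right_strands p ?t = insert (p, q) (right_strands p a \<union> left_strands q b \<union> right_strands q c)"
      by (simp_all add: q_def Let_def Un_assoc)
    have E: "arcs_right p a \<subseteq> E" "arcs_left q b \<subseteq> E" "arcs_right q c \<subseteq> E" "(p, q) \<in> E"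
      using 1(1) by (simp_all add: q_def Let_def)
    have sub: "right_strands p a \<subseteq> D" "left_strands q b \<subseteq> D" "right_strands q c \<subseteq> D"
      using 1(2) unfolding T by auto
    have C: "(x, y) = (p, q) \<or> (x, y) \<in> right_strands p a \<or> (x, y) \<in> left_strands q b \<or> (x, y) \<in> right_strands q c"
      if "(x, y) \<in> D" "(p < x \<and> x \<le> q + num_nodes c) \<or> (p < y \<and> y \<le> q + num_nodes c)" for x y
      using 1(3)[OF that(1)] that(2) unfolding T by (auto simp: q_def)
    have Ba: "p \<le> x \<and> x < y \<and> y \<le> p + num_nodes a" if "(x, y) \<in> right_strands p a" for x y
      using place_bounds(1)[OF that] .
    have Bb: "p + num_nodes a < x \<and> x < y \<and> y \<le> q" if "(x, y) \<in> left_strands q b" for x y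
      using place_bounds(2)[OF that] by (simp add: q_def)
    have Bc: "q \<le> x \<and> x < y \<and> y \<le> q + num_nodes c" if "(x, y) \<in> right_strands q c" for x y
      using place_bounds(1)[OF that] .
    have q: "p + num_nodes a < q" "q - num_nodes b = p + num_nodes a + 1" "num_nodes b \<le> q"
      by (simp_all add: q_def)
    have R': "oriented_right D (p, q)"
      using R E(4) .
    \<comment> \<open>Locality reduces the selection from \<open>D\<close> to subtree
      \<open>a\<close>: strands of \<open>b\<close> and \<open>c\<close> start to the right of
      \<open>p\<close>, and the root itself is excluded by \<open>x < q\<close>. The selections for
      the other two children reduce in the same way.\<close>
    have "p < x \<and> x < q \<and> (p, x) \<in> D \<longleftrightarrow> (p, x) \<in> right_strands p a" for x
      using C[of p x] Ba[of p x] Bb[of p x] Bc[of p x] q sub by auto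
    then have "child_a D (p, q) = root_of (place_right p a)"
      by (simp add: child_a_def Let_def root_of_place_right R')
    moreover have "p < x \<and> x < q \<and> (x, q) \<in> D \<longleftrightarrow> (x, q) \<in> left_strands q b" for x
      using C[of x q] Ba[of x q] Bb[of x q] Bc[of x q] q sub by auto
    then have "child_b D (p, q) = root_of (place_left q b)"
      using longest_same_end[of "{x. (x, q) \<in> left_strands q b}" q] Bb
      by (simp add: child_b_def root_of_place_left q(3) R')
    moreover have "q < x \<and> (q, x) \<in> D \<longleftrightarrow> (q, x) \<in> right_strands q c" for x
      using C[of q x] Ba[of q x] Bb[of q x] Bc[of q x] q sub by auto
    then have "child_c D (p, q) = root_of (place_right q c)"
      by (simp add: child_c_def root_of_place_right R' Let_def)
    moreover have "grows D (root_of (place_right p a)) (place_right p a)"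
    proof (rule Node.IH(1)[OF E(1) sub(1)])
      show "(x, y) \<in> right_strands p a"
        if "(x, y) \<in> D" "x \<in> {p<..p + num_nodes a} \<or> y \<in> {p<..p + num_nodes a}" for x y
        using C[OF that(1)] Bb[of x y] Bc[of x y] that(2) q by auto
    qed
    moreover have "grows D (root_of (place_left q b)) (place_left q b)"
    proof (rule Node.IH(4)[OF q(3) E(2) sub(2)])
      show "(x, y) \<in> left_strands q b"
        if "(x, y) \<in> D" "x \<in> {q - num_nodes b..<q} \<or> y \<in> {q - num_nodes b..<q}" for x y
        using C[OF that(1)] Ba[of x y] Bc[of x y] that(2) q by auto
    qed
    moreover have "grows D (root_of (place_right q c)) (place_right q c)"
    proof (rule Node.IH(5)[OF E(3) sub(3)])
      show "(x, y) \<in> right_strands q c"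
        if "(x, y) \<in> D" "x \<in> {q<..q + num_nodes c} \<or> y \<in> {q<..q + num_nodes c}" for x y
        using C[OF that(1)] Ba[of x y] Bb[of x y] that(2) q by auto
    qed
    ultimately show ?case
      unfolding place root_of.simps by (intro grows.node) simp_all
  next
    case 2
    let ?t = "Node l a b c"
    define q where "q = p - (num_nodes a + num_nodes b + 1)"
    have place: "place_left p ?t = Node (q, p) (place_left p a) (place_right q b) (place_left q c)"
      and T: "left_strands p ?t = insert (q, p) (left_strands p a \<union> right_strands q b \<union> left_strands q c)"
      by (simp_all add: q_def Let_def Un_assoc)
    have E: "arcs_left p a \<subseteq> E" "arcs_right q b \<subseteq> E" "arcs_left q c \<subseteq> E" "(p, q) \<in> E"
      using 2(2) by (simp_all add: q_def Let_def)
    have sub: "left_strands p a \<subseteq> D" "right_strands q b \<subseteq> D" "left_strands q c \<subseteq> D"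
      using 2(3) unfolding T by auto
    have qp: "p = q + num_nodes a + num_nodes b + 1"
      using 2(1) by (simp add: q_def)
    have q: "q + num_nodes b < p" "p - num_nodes a = q + num_nodes b + 1" "num_nodes a \<le> p" "num_nodes c \<le> q"
      "p - num_nodes ?t = q - num_nodes c"
      using 2(1) by (simp_all add: qp)
    have C: "(x, y) = (q, p) \<or> (x, y) \<in> left_strands p a \<or> (x, y) \<in> right_strands q b \<or> (x, y) \<in> left_strands q c"
      if "(x, y) \<in> D" "(q - num_nodes c \<le> x \<and> x < p) \<or> (q - num_nodes c \<le> y \<and> y < p)" for x y
      using 2(4)[OF that(1)] that(2) unfolding T q(5) by auto
    have Ba: "q + num_nodes b < x \<and> x < y \<and> y \<le> p" if "(x, y) \<in> left_strands p a" for x y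
      using place_bounds(2)[OF that q(3)] q by auto
    have Bb: "q \<le> x \<and> x < y \<and> y \<le> q + num_nodes b" if "(x, y) \<in> right_strands q b" for x y
      using place_bounds(1)[OF that] .
    have Bc: "q - num_nodes c \<le> x \<and> x < y \<and> y \<le> q" if "(x, y) \<in> left_strands q c" for x y
      using place_bounds(2)[OF that q(4)] .
    have qx: "q - num_nodes c \<le> x" if "q \<le> x" for x
      using that by simp
    have L': "\<not> oriented_right D (q, p)"
      using L E(4) .
    have "q < x \<and> x < p \<and> (x, p) \<in> D \<longleftrightarrow> (x, p) \<in> left_strands p a" for x
      using C[of x p] qx[of x] Ba[of x p] Bb[of x p] Bc[of x p] q sub by auto
    then have "child_a D (q, p) = root_of (place_left p a)"
      by (simp add: child_a_def Let_def root_of_place_left q(3) L')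
    moreover have "q < x \<and> x < p \<and> (q, x) \<in> D \<longleftrightarrow> (q, x) \<in> right_strands q b" for x
      using C[of q x] qx[of x] Ba[of q x] Bb[of q x] Bc[of q x] q sub by auto
    moreover have "finite {x. (q, x) \<in> right_strands q b}"
      by (rule finite_subset[of _ "{..q + num_nodes b}"]) (use Bb in auto)
    ultimately have "child_b D (q, p) = root_of (place_right q b)"
      using longest_same_start[of "{x. (q, x) \<in> right_strands q b}" q] Bb
      by (simp add: child_b_def root_of_place_right L')
    moreover have "x < q \<and> (x, q) \<in> D \<longleftrightarrow> (x, q) \<in> left_strands q c" for x
      using C[of x q] Ba[of x q] Bb[of x q] Bc[of x q] q sub by auto
    then have "child_c D (q, p) = root_of (place_left q c)"
      using longest_same_end[of "{x. (x, q) \<in> left_strands q c}" q] Bc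
      by (simp add: child_c_def root_of_place_left q(4) L')
    moreover have "grows D (root_of (place_left p a)) (place_left p a)"
    proof (rule Node.IH(2)[OF q(3) E(1) sub(1)])
      show "(x, y) \<in> left_strands p a"
        if "(x, y) \<in> D" "x \<in> {p - num_nodes a..<p} \<or> y \<in> {p - num_nodes a..<p}" for x y
      proof -
        have "(q - num_nodes c \<le> x \<and> x < p) \<or> (q - num_nodes c \<le> y \<and> y < p)"
          using that(2) q by auto
        from C[OF that(1) this] show ?thesis
          using Bb[of x y] Bc[of x y] that(2) q by auto
      qed
    qed
    moreover have "grows D (root_of (place_right q b)) (place_right q b)"
    proof (rule Node.IH(3)[OF E(2) sub(2)])
      show "(x, y) \<in> right_strands q b"
        if "(x, y) \<in> D" "x \<in> {q<..q + num_nodes b} \<or> y \<in> {q<..q + num_nodes b}" for x y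
      proof -
        have "(q - num_nodes c \<le> x \<and> x < p) \<or> (q - num_nodes c \<le> y \<and> y < p)"
          using that(2) q by auto
        from C[OF that(1) this] show ?thesis
          using Ba[of x y] Bc[of x y] that(2) q by auto
      qed
    qed
    moreover have "grows D (root_of (place_left q c)) (place_left q c)"
    proof (rule Node.IH(6)[OF q(4) E(3) sub(3)])
      show "(x, y) \<in> left_strands q c"
        if "(x, y) \<in> D" "x \<in> {q - num_nodes c..<q} \<or> y \<in> {q - num_nodes c..<q}" for x y
      proof -
        have "(q - num_nodes c \<le> x \<and> x < p) \<or> (q - num_nodes c \<le> y \<and> y < p)"
          using that(2) q by auto
        from C[OF that(1) this] show ?thesis
          using Ba[of x y] Bb[of x y] that(2) q by auto
      qed
    qed
    ultimately show ?case
      unfolding place root_of.simps using \<open>child_a D (q, p) = _\<close> by (intro grows.node) simp_all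
  }
qed

lemma grows_unique: "grows D r t \<Longrightarrow> grows D r t' \<Longrightarrow> t = t'"
proof (induction arbitrary: t' rule: grows.induct)
  case leaf
  then show ?case by (auto elim: grows.cases)
next
  case (node X ta tb tc)
  from node.prems node.IH show ?case by (auto elim!: grows.cases[of _ "Some _"])
qed

text \<open>The diagram is the tree's own set of strands, so locality is immediate, and its arcs
  supply the orientation through \<open>directed_diagram\<close>.\<close>

lemma grows_right_strands:
  fixes t :: "unit ttree"
  assumes "num_nodes t \<ge> 1"
  shows "grows (right_strands 0 t) (Some (root_strand (right_strands 0 t))) (place_right 0 t)"
proof -
  define D where "D = right_strands 0 t"
  interpret directed_diagram D "arcs_right 0 t"
  proof
    show "x = y" if "(x, z) \<in> arcs_right 0 t" "(y, z) \<in> arcs_right 0 t" for x y z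
      using arcs_parent_unique(1)[OF that] .
    show "(x, 0) \<notin> arcs_right 0 t" for x
      using arcs_bounds(1)[of x 0 0 t] by auto
    show "(x, y) \<in> D \<or> (y, x) \<in> D \<longleftrightarrow> (x, y) \<in> arcs_right 0 t \<or> (y, x) \<in> arcs_right 0 t" for x y
      using strands_iff_arcs(1)[of x y 0 t] strands_iff_arcs(1)[of y x 0 t]
        arcs_bounds(1)[of x y 0 t] arcs_bounds(1)[of y x 0 t]
      unfolding D_def by linarith
    show "(0, x) \<in> (arcs_right 0 t)\<^sup>*" if "(x, y) \<in> arcs_right 0 t" for x y
      using arcs_reach(1)[OF that] .
  qed
  have "grows D (root_of (place_right 0 t)) (place_right 0 t)"
    by (rule grows_place(1)[of "arcs_right 0 t"]) (use oriented in \<open>auto simp: D_def\<close>)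
  moreover have "root_of (place_right 0 t) = Some (root_strand D)"
  proof -
    obtain l a b c where "t = Node l a b c"
      using assms by (cases t) auto
    then have "root_of (place_right 0 t) \<noteq> None"
      by (simp add: Let_def)
    then show ?thesis
      unfolding root_of_place_right root_strand_def D_def by (auto split: if_splits)
  qed
  ultimately show ?thesis
    unfolding D_def by simp
qed

section \<open>Representations\<close>

lemma empty_mat_eq:
  assumes "A \<in> carrier_mat r c" "B \<in> carrier_mat r c" "r = 0 \<or> c = 0"
  shows "A = B"
  using assms by (intro eq_matI) auto

lemma mult_mat_of_col:
  assumes "A \<in> carrier_mat r c" "x \<in> carrier_vec c"
  shows "A * mat_of_cols c [x] = mat_of_cols r [A *\<^sub>v x]"
  using assms
  by (intro eq_matI) (auto simp: mat_of_cols_index scalar_prod_def)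

lemma mat_of_col_unit_vec: "mat_of_cols 1 [unit_vec 1 0] = 1\<^sub>m 1"
  by (intro eq_matI) (auto simp: mat_of_cols_index)

section \<open>Morphisms, isomorphism invariance of Hom and Ext\<close>

lemma repsI:
  "(\<And>m. 1 \<le> m \<Longrightarrow> m < n \<Longrightarrow> arrow V m \<in> carrier_mat (dim_at V (Suc m)) (dim_at V m)) \<Longrightarrow> V \<in> reps n"
  by (simp add: reps_def)

lemma arrow_carrier:
  "V \<in> reps n \<Longrightarrow> 1 \<le> m \<Longrightarrow> m < n \<Longrightarrow> arrow V m \<in> carrier_mat (dim_at V (Suc m)) (dim_at V m)"
  by (simp add: reps_def)

lemma homsI:
  assumes "\<And>m. 1 \<le> m \<Longrightarrow> m \<le> n \<Longrightarrow> f m \<in> carrier_mat (dim_at W m) (dim_at V m)"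
    and "\<And>m. 1 \<le> m \<Longrightarrow> m < n \<Longrightarrow> f (Suc m) * arrow V m = arrow W m * f m"
  shows "f \<in> homs n V W"
  using assms by (simp add: homs_def)

lemma hom_carrier:
  "f \<in> homs n V W \<Longrightarrow> 1 \<le> m \<Longrightarrow> m \<le> n \<Longrightarrow> f m \<in> carrier_mat (dim_at W m) (dim_at V m)"
  by (simp add: homs_def)

lemma hom_arrow:
  "f \<in> homs n V W \<Longrightarrow> 1 \<le> m \<Longrightarrow> m < n \<Longrightarrow> f (Suc m) * arrow V m = arrow W m * f m"
  by (simp add: homs_def)

lemma hom_arrow_vec:
  assumes "V \<in> reps n" "W \<in> reps n" "f \<in> homs n V W" "1 \<le> m" "m < n" "x \<in> carrier_vec (dim_at V m)"
  shows "f (Suc m) *\<^sub>v (arrow V m *\<^sub>v x) = arrow W m *\<^sub>v (f m *\<^sub>v x)"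
proof -
  have "(f (Suc m) * arrow V m) *\<^sub>v x = (arrow W m * f m) *\<^sub>v x"
    using assms by (simp add: hom_arrow)
  then show ?thesis
    using assms by (simp add: assoc_mult_mat_vec[OF hom_carrier arrow_carrier]
        assoc_mult_mat_vec[OF arrow_carrier hom_carrier])
qed

lemma id_hom:
  assumes "V \<in> reps n"
  shows "(\<lambda>m. 1\<^sub>m (dim_at V m)) \<in> homs n V V"
  by (intro homsI) (simp_all add: left_mult_one_mat[OF arrow_carrier[OF assms]]
      right_mult_one_mat[OF arrow_carrier[OF assms]])

lemma hom_comp:
  assumes reps: "U \<in> reps n" "V \<in> reps n" "W \<in> reps n" and f: "f \<in> homs n U V" and g: "g \<in> homs n V W"
  shows "(\<lambda>m. g m * f m) \<in> homs n U W"
proof (rule homsI)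
  show "g m * f m \<in> carrier_mat (dim_at W m) (dim_at U m)" if "1 \<le> m" "m \<le> n" for m
    using hom_carrier[OF f that] hom_carrier[OF g that] by simp
  show "g (Suc m) * f (Suc m) * arrow U m = arrow W m * (g m * f m)" if m: "1 \<le> m" "m < n" for m
  proof -
    have c: "f m \<in> carrier_mat (dim_at V m) (dim_at U m)" "g m \<in> carrier_mat (dim_at W m) (dim_at V m)"
      "f (Suc m) \<in> carrier_mat (dim_at V (Suc m)) (dim_at U (Suc m))"
      "g (Suc m) \<in> carrier_mat (dim_at W (Suc m)) (dim_at V (Suc m))"
      using m by (auto intro!: hom_carrier[OF f] hom_carrier[OF g])
    note a = arrow_carrier[OF reps(1) m] arrow_carrier[OF reps(2) m] arrow_carrier[OF reps(3) m]
    have "g (Suc m) * f (Suc m) * arrow U m = g (Suc m) * (arrow V m * f m)"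
      by (simp add: assoc_mult_mat[OF c(4,3) a(1)] hom_arrow[OF f m])
    also have "\<dots> = arrow W m * g m * f m"
      by (simp add: assoc_mult_mat[OF c(4) a(2) c(1), symmetric] hom_arrow[OF g m])
    also have "\<dots> = arrow W m * (g m * f m)"
      by (rule assoc_mult_mat[OF a(3) c(2,1)])
    finally show ?thesis .
  qed
qed

lemma isomorphic_refl:
  assumes "V \<in> reps n"
  shows "isomorphic n V V"
  unfolding isomorphic_def by (rule bexI[OF _ id_hom[OF assms]])+ simp

lemma isomorphic_sym: "isomorphic n V W \<Longrightarrow> isomorphic n W V"
  unfolding isomorphic_def by blast

lemma isomorphicE:
  assumes "isomorphic n V W"
  obtains f g where "f \<in> homs n V W" "g \<in> homs n W V"
    "\<And>m. 1 \<le> m \<Longrightarrow> m \<le> n \<Longrightarrow> g m * f m = 1\<^sub>m (dim_at V m)"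
    "\<And>m. 1 \<le> m \<Longrightarrow> m \<le> n \<Longrightarrow> f m * g m = 1\<^sub>m (dim_at W m)"
  using assms unfolding isomorphic_def by auto

lemma mult_cancel_middle:
  assumes "A \<in> carrier_mat p q" "B \<in> carrier_mat q r" "C \<in> carrier_mat r q" "D \<in> carrier_mat q s"
    and "B * C = 1\<^sub>m q"
  shows "(A * B) * (C * D) = A * (D :: 'a :: semiring_1 mat)"
proof -
  have "(A * B) * (C * D) = A * (B * (C * D))"
    using assms by (intro assoc_mult_mat) auto
  also have "B * (C * D) = (B * C) * D"
    using assms by (intro assoc_mult_mat[symmetric]) auto
  finally show ?thesis
    using assms by simp
qed

lemma assoc_mult_mat5:
  assumes "A \<in> carrier_mat p q" "B \<in> carrier_mat q r" "C \<in> carrier_mat r s" "D \<in> carrier_mat s t"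
    "F \<in> carrier_mat t u"
  shows "(A * B) * (C * (D * F)) = A * ((B * (C * D)) * (F :: 'a :: semiring_0 mat))"
  using assoc_mult_mat[OF assms(1,2) mult_carrier_mat[OF assms(3) mult_carrier_mat[OF assms(4,5)]]]
    assoc_mult_mat[OF assms(2) mult_carrier_mat[OF assms(3,4)] assms(5)] assoc_mult_mat[OF assms(3-5)]
  by simp

lemma isomorphic_trans:
  assumes reps: "U \<in> reps n" "V \<in> reps n" "W \<in> reps n"
    and UV: "isomorphic n U V" and VW: "isomorphic n V W"
  shows "isomorphic n U W"
proof -
  obtain f f' where f: "f \<in> homs n U V" "f' \<in> homs n V U"
    "\<And>m. 1 \<le> m \<Longrightarrow> m \<le> n \<Longrightarrow> f' m * f m = 1\<^sub>m (dim_at U m)"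
    "\<And>m. 1 \<le> m \<Longrightarrow> m \<le> n \<Longrightarrow> f m * f' m = 1\<^sub>m (dim_at V m)"
    using isomorphicE[OF UV] by blast
  obtain g g' where g: "g \<in> homs n V W" "g' \<in> homs n W V"
    "\<And>m. 1 \<le> m \<Longrightarrow> m \<le> n \<Longrightarrow> g' m * g m = 1\<^sub>m (dim_at V m)"
    "\<And>m. 1 \<le> m \<Longrightarrow> m \<le> n \<Longrightarrow> g m * g' m = 1\<^sub>m (dim_at W m)"
    using isomorphicE[OF VW] by blast
  have "(f' m * g' m) * (g m * f m) = 1\<^sub>m (dim_at U m) \<and> (g m * f m) * (f' m * g' m) = 1\<^sub>m (dim_at W m)"
    if m: "1 \<le> m" "m \<le> n" for m
    using mult_cancel_middle[OF hom_carrier[OF f(2) m] hom_carrier[OF g(2) m] hom_carrier[OF g(1) m] hom_carrier[OF f(1) m] g(3)[OF m]]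
      mult_cancel_middle[OF hom_carrier[OF g(1) m] hom_carrier[OF f(1) m] hom_carrier[OF f(2) m] hom_carrier[OF g(2) m] f(4)[OF m]]
      f(3)[OF m] g(4)[OF m] by simp
  then show ?thesis
    unfolding isomorphic_def
    by (intro bexI[OF _ hom_comp[OF reps f(1) g(1)]] bexI[OF _ hom_comp[OF reps(3,2,1) g(2) f(2)]]) auto
qed

lemma iso_class_eq_iff:
  assumes "V \<in> reps n" "W \<in> reps n"
  shows "iso_class n V = iso_class n W \<longleftrightarrow> isomorphic n V W"
  unfolding iso_class_def
  using assms isomorphic_refl isomorphic_sym isomorphic_trans by blast

text \<open>Pointwise inverses of a morphism commute with the arrows automatically: multiply the
  commuting square of \<open>f\<close> by \<open>g\<close> on both sides.\<close>

lemma isomorphicI: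
  assumes reps: "V \<in> reps n" "W \<in> reps n" and f: "f \<in> homs n V W"
    and g: "\<And>m. 1 \<le> m \<Longrightarrow> m \<le> n \<Longrightarrow> g m \<in> carrier_mat (dim_at V m) (dim_at W m)"
    and gf: "\<And>m. 1 \<le> m \<Longrightarrow> m \<le> n \<Longrightarrow> g m * f m = 1\<^sub>m (dim_at V m)"
    and fg: "\<And>m. 1 \<le> m \<Longrightarrow> m \<le> n \<Longrightarrow> f m * g m = 1\<^sub>m (dim_at W m)"
  shows "isomorphic n V W"
proof -
  have "g \<in> homs n W V"
  proof (rule homsI[OF g])
    fix m assume m: "1 \<le> m" "m < n"
    then have m': "1 \<le> m" "m \<le> n" "1 \<le> Suc m" "Suc m \<le> n"
      by auto
    note c = hom_carrier[OF f m'(1,2)] hom_carrier[OF f m'(3,4)] g[OF m'(1,2)] g[OF m'(3,4)]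
    note a = arrow_carrier[OF reps(1) m] arrow_carrier[OF reps(2) m]
    have "g (Suc m) * arrow W m = g (Suc m) * (arrow W m * (f m * g m))"
      using a by (simp add: fg[OF m'(1,2)] right_mult_one_mat[OF a(2)])
    also have "\<dots> = g (Suc m) * ((f (Suc m) * arrow V m) * g m)"
      by (simp add: assoc_mult_mat[OF a(2) c(1) c(3)] hom_arrow[OF f m])
    also have "\<dots> = (g (Suc m) * f (Suc m)) * (arrow V m * g m)"
      using assoc_mult_mat[OF c(4,2) mult_carrier_mat[OF a(1) c(3)]] a c by simp
    also have "\<dots> = arrow V m * g m"
      using a c by (simp add: gf[OF m'(3,4)])
    finally show "g (Suc m) * arrow W m = arrow V m * g m" .
  qed
  then show ?thesis
    unfolding isomorphic_def using f gf fg by (intro bexI[of _ f] bexI[of _ g]) auto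
qed

lemma Hom_zeroD:
  "Hom_zero n V W \<Longrightarrow> f \<in> homs n V W \<Longrightarrow> 1 \<le> m \<Longrightarrow> m \<le> n \<Longrightarrow> f m = 0\<^sub>m (dim_at W m) (dim_at V m)"
  by (simp add: Hom_zero_def)

text \<open>A morphism \<open>f\<close> between the primed objects is recovered from its conjugate
  \<open>q' f p\<close>, which is a morphism from \<open>V\<close> to \<open>W\<close> and hence
  zero.\<close>

lemma Hom_zero_isomorphic:
  assumes reps: "V \<in> reps n" "V' \<in> reps n" "W \<in> reps n" "W' \<in> reps n"
    and V: "isomorphic n V V'" and W: "isomorphic n W W'" and zero: "Hom_zero n V W"
  shows "Hom_zero n V' W'"
proof -
  obtain p p' where p: "p \<in> homs n V V'" "p' \<in> homs n V' V"
    "\<And>m. 1 \<le> m \<Longrightarrow> m \<le> n \<Longrightarrow> p' m * p m = 1\<^sub>m (dim_at V m)"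
    "\<And>m. 1 \<le> m \<Longrightarrow> m \<le> n \<Longrightarrow> p m * p' m = 1\<^sub>m (dim_at V' m)"
    using isomorphicE[OF V] by blast
  obtain q q' where q: "q \<in> homs n W W'" "q' \<in> homs n W' W"
    "\<And>m. 1 \<le> m \<Longrightarrow> m \<le> n \<Longrightarrow> q' m * q m = 1\<^sub>m (dim_at W m)"
    "\<And>m. 1 \<le> m \<Longrightarrow> m \<le> n \<Longrightarrow> q m * q' m = 1\<^sub>m (dim_at W' m)"
    using isomorphicE[OF W] by blast
  have "f m = 0\<^sub>m (dim_at W' m) (dim_at V' m)" if f: "f \<in> homs n V' W'" and m: "1 \<le> m" "m \<le> n" for f m
  proof -
    note c = hom_carrier[OF f m] hom_carrier[OF p(1) m] hom_carrier[OF p(2) m]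
      hom_carrier[OF q(1) m] hom_carrier[OF q(2) m]
    have "(\<lambda>m. q' m * (f m * p m)) \<in> homs n V W"
      by (rule hom_comp[OF reps(1,4,3) hom_comp[OF reps(1,2,4) p(1) f] q(2)])
    then have z: "q' m * (f m * p m) = 0\<^sub>m (dim_at W m) (dim_at V m)"
      using Hom_zeroD[OF zero _ m] by fastforce
    have "f m = (q m * q' m) * (f m * (p m * p' m))"
      using c by (simp only: p(4)[OF m] q(4)[OF m] left_mult_one_mat right_mult_one_mat)
    also have "\<dots> = q m * ((q' m * (f m * p m)) * p' m)"
      by (rule assoc_mult_mat5[OF c(4,5,1,2,3)])
    finally show ?thesis
      using c by (simp only: z) simp
  qed
  then show ?thesis
    by (simp add: Hom_zero_def)
qed

lemma short_exactD:
  assumes "short_exact n W f E g V"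
  shows "f \<in> homs n W E" "g \<in> homs n E V"
    and "1 \<le> m \<Longrightarrow> m \<le> n \<Longrightarrow> inj_on ((*\<^sub>v) (f m)) (carrier_vec (dim_at W m))"
    and "1 \<le> m \<Longrightarrow> m \<le> n \<Longrightarrow> (*\<^sub>v) (f m) ` carrier_vec (dim_at W m) = mat_kernel (g m)"
    and "1 \<le> m \<Longrightarrow> m \<le> n \<Longrightarrow> (*\<^sub>v) (g m) ` carrier_vec (dim_at E m) = carrier_vec (dim_at V m)"
  using assms by (auto simp: short_exact_def)

lemma mult_mat_vec_image:
  assumes "A \<in> carrier_mat r c" "B \<in> carrier_mat c d"
  shows "(*\<^sub>v) (A * B) ` carrier_vec d = (*\<^sub>v) A ` ((*\<^sub>v) B ` carrier_vec d)"
  using assms by (auto simp: image_image intro!: image_cong)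

lemma inverse_mat_image:
  assumes "A \<in> carrier_mat r c" "B \<in> carrier_mat c r" "A * B = 1\<^sub>m r"
  shows "(*\<^sub>v) A ` carrier_vec c = (carrier_vec r :: 'a :: semiring_1 vec set)"
proof
  show "carrier_vec r \<subseteq> (*\<^sub>v) A ` carrier_vec c"
  proof
    fix x :: "'a vec" assume x: "x \<in> carrier_vec r"
    then have "A *\<^sub>v (B *\<^sub>v x) = x"
      using assms by (simp flip: assoc_mult_mat_vec[OF assms(1,2)])
    then show "x \<in> (*\<^sub>v) A ` carrier_vec c"
      using assms(2) x by (metis image_eqI mult_mat_vec_carrier)
  qed
qed (use assms in auto)

text \<open>The middle term is kept and only the ends are exchanged, so that a section of the new
  sequence still has values in the same \<open>E\<close>.\<close>

lemma short_exact_isomorphic: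
  assumes reps: "V \<in> reps n" "V' \<in> reps n" "W \<in> reps n" "W' \<in> reps n" "E \<in> reps n"
    and q: "q \<in> homs n W W'" "q' \<in> homs n W' W"
      "\<And>m. 1 \<le> m \<Longrightarrow> m \<le> n \<Longrightarrow> q' m * q m = 1\<^sub>m (dim_at W m)"
      "\<And>m. 1 \<le> m \<Longrightarrow> m \<le> n \<Longrightarrow> q m * q' m = 1\<^sub>m (dim_at W' m)"
    and p: "p \<in> homs n V V'" "p' \<in> homs n V' V"
      "\<And>m. 1 \<le> m \<Longrightarrow> m \<le> n \<Longrightarrow> p' m * p m = 1\<^sub>m (dim_at V m)"
      "\<And>m. 1 \<le> m \<Longrightarrow> m \<le> n \<Longrightarrow> p m * p' m = 1\<^sub>m (dim_at V' m)"
    and ex: "short_exact n W' f E g V'"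
  shows "short_exact n W (\<lambda>m. f m * q m) E (\<lambda>m. p' m * g m) V"
  unfolding short_exact_def
proof (intro conjI ballI)
  note fg = short_exactD[OF ex]
  show "(\<lambda>m. f m * q m) \<in> homs n W E" "(\<lambda>m. p' m * g m) \<in> homs n E V"
    using hom_comp[OF reps(3,4,5) q(1) fg(1)] hom_comp[OF reps(5,2,1) fg(2) p(2)] by simp_all
  fix m assume "m \<in> {1..n}"
  then have m: "1 \<le> m" "m \<le> n" by auto
  note c = hom_carrier[OF fg(1) m] hom_carrier[OF fg(2) m] hom_carrier[OF q(1) m] hom_carrier[OF q(2) m]
    hom_carrier[OF p(1) m] hom_carrier[OF p(2) m]
  show "inj_on ((*\<^sub>v) (f m * q m)) (carrier_vec (dim_at W m))"
  proof (rule inj_onI)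
    fix x y assume x: "x \<in> carrier_vec (dim_at W m)" and y: "y \<in> carrier_vec (dim_at W m)"
      and eq: "f m * q m *\<^sub>v x = f m * q m *\<^sub>v y"
    have "q m *\<^sub>v x = q m *\<^sub>v y"
      using inj_onD[OF fg(3)[OF m], of "q m *\<^sub>v x" "q m *\<^sub>v y"] eq c x y by simp
    then have "(q' m * q m) *\<^sub>v x = (q' m * q m) *\<^sub>v y"
      using c x y by simp
    then show "x = y"
      using x y by (simp add: q(3)[OF m])
  qed
  have "x \<in> mat_kernel (p' m * g m) \<longleftrightarrow> x \<in> mat_kernel (g m)" for x
  proof
    assume "x \<in> mat_kernel (p' m * g m)"
    then have x: "x \<in> carrier_vec (dim_at E m)" "p' m *\<^sub>v (g m *\<^sub>v x) = 0\<^sub>v (dim_at V m)"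
      using mat_kernelD[OF mult_carrier_mat[OF c(6,2)]] c by auto
    have "g m *\<^sub>v x = (p m * p' m) *\<^sub>v (g m *\<^sub>v x)"
      using c x by (simp only: p(4)[OF m]) simp
    also have "\<dots> = p m *\<^sub>v (p' m *\<^sub>v (g m *\<^sub>v x))"
      using c x by simp
    also have "\<dots> = 0\<^sub>v (dim_at V' m)"
      using c unfolding x(2) by (intro eq_vecI) auto
    finally show "x \<in> mat_kernel (g m)"
      using mat_kernelI[OF c(2) x(1)] by simp
  next
    assume "x \<in> mat_kernel (g m)"
    then show "x \<in> mat_kernel (p' m * g m)"
      using mat_kernel_mult_subset[OF c(2,6)] by auto
  qed
  then show "(*\<^sub>v) (f m * q m) ` carrier_vec (dim_at W m) = mat_kernel (p' m * g m)"
    unfolding mult_mat_vec_image[OF c(1,3)] inverse_mat_image[OF c(3,4) q(4)[OF m]] fg(4)[OF m] by blast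
  show "(*\<^sub>v) (p' m * g m) ` carrier_vec (dim_at E m) = carrier_vec (dim_at V m)"
    unfolding mult_mat_vec_image[OF c(6,2)] fg(5)[OF m] inverse_mat_image[OF c(6,5) p(3)[OF m]] ..
qed

text \<open>If \<open>s\<close> is a section of \<open>p' g\<close>, then \<open>s p'\<close> is a
  section of \<open>g\<close>: it suffices to conjugate the splitting identity by
  \<open>p\<close>.\<close>

lemma Ext1_zero_isomorphic:
  assumes reps: "V \<in> reps n" "V' \<in> reps n" "W \<in> reps n" "W' \<in> reps n"
    and V: "isomorphic n V V'" and W: "isomorphic n W W'" and zero: "Ext1_zero n V W"
  shows "Ext1_zero n V' W'"
  unfolding Ext1_zero_def
proof (intro ballI allI impI)
  fix E f g assume E: "E \<in> reps n" and ex: "short_exact n W' f E g V'"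
  obtain p p' where p: "p \<in> homs n V V'" "p' \<in> homs n V' V"
    "\<And>m. 1 \<le> m \<Longrightarrow> m \<le> n \<Longrightarrow> p' m * p m = 1\<^sub>m (dim_at V m)"
    "\<And>m. 1 \<le> m \<Longrightarrow> m \<le> n \<Longrightarrow> p m * p' m = 1\<^sub>m (dim_at V' m)"
    using isomorphicE[OF V] by blast
  obtain q q' where q: "q \<in> homs n W W'" "q' \<in> homs n W' W"
    "\<And>m. 1 \<le> m \<Longrightarrow> m \<le> n \<Longrightarrow> q' m * q m = 1\<^sub>m (dim_at W m)"
    "\<And>m. 1 \<le> m \<Longrightarrow> m \<le> n \<Longrightarrow> q m * q' m = 1\<^sub>m (dim_at W' m)"
    using isomorphicE[OF W] by blast
  have "short_exact n W (\<lambda>m. f m * q m) E (\<lambda>m. p' m * g m) V"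
    by (rule short_exact_isomorphic[OF reps E q p ex])
  with zero E obtain s where s: "s \<in> homs n V E"
    "\<And>m. 1 \<le> m \<Longrightarrow> m \<le> n \<Longrightarrow> p' m * g m * s m = 1\<^sub>m (dim_at V m)"
    unfolding Ext1_zero_def by fastforce
  show "\<exists>s\<in>homs n V' E. \<forall>m\<in>{1..n}. g m * s m = 1\<^sub>m (dim_at V' m)"
  proof (intro bexI[OF _ hom_comp[OF reps(2,1) E p(2) s(1)]] ballI)
    fix m assume "m \<in> {1..n}"
    then have m: "1 \<le> m" "m \<le> n" by auto
    note c = hom_carrier[OF short_exactD(2)[OF ex] m] hom_carrier[OF s(1) m]
      hom_carrier[OF p(1) m] hom_carrier[OF p(2) m]
    have "g m * (s m * p' m) = (p m * p' m) * (g m * (s m * p' m))"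
      using c by (simp only: p(4)[OF m]) simp
    also have "\<dots> = p m * ((p' m * g m * s m) * p' m)"
      by (simp only: assoc_mult_mat5[OF c(3,4,1,2,4)] assoc_mult_mat[OF c(4,1,2)])
    also have "\<dots> = 1\<^sub>m (dim_at V' m)"
      using c by (simp only: s(2)[OF m]) (simp add: p(4)[OF m])
    finally show "g m * (s m * p' m) = 1\<^sub>m (dim_at V' m)" .
  qed
qed

section \<open>Extensions given by block triangular arrows\<close>

definition proj1 :: "nat \<Rightarrow> nat \<Rightarrow> 'a::semiring_1 mat" where
  "proj1 a b = mat a (a + b) (\<lambda>(i, j). if j = i then 1 else 0)"

definition proj2 :: "nat \<Rightarrow> nat \<Rightarrow> 'a::semiring_1 mat" where
  "proj2 a b = mat b (a + b) (\<lambda>(i, j). if j = a + i then 1 else 0)"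

definition incl1 :: "nat \<Rightarrow> nat \<Rightarrow> 'a::semiring_1 mat" where
  "incl1 a b = mat (a + b) a (\<lambda>(i, j). if i = j then 1 else 0)"

lemma proj_incl_carrier [simp]:
  "proj1 a b \<in> carrier_mat a (a + b)" "proj2 a b \<in> carrier_mat b (a + b)"
  "incl1 a b \<in> carrier_mat (a + b) a"
  by (simp_all add: proj1_def proj2_def incl1_def)

lemma proj1_mult:
  "A \<in> carrier_mat (a + b) c \<Longrightarrow> proj1 a b * A = mat a c (\<lambda>(i, j). A $$ (i, j))"
  by (intro eq_matI) (auto simp: proj1_def scalar_prod_def if_distrib[of "\<lambda>x. x * _"] cong: if_cong)

lemma proj2_mult:
  "A \<in> carrier_mat (a + b) c \<Longrightarrow> proj2 a b * A = mat b c (\<lambda>(i, j). A $$ (a + i, j))"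
  by (intro eq_matI) (auto simp: proj2_def scalar_prod_def if_distrib[of "\<lambda>x. x * _"] cong: if_cong)

lemma proj2_mult_vec:
  "x \<in> carrier_vec (a + b) \<Longrightarrow> proj2 a b *\<^sub>v x = vec b (\<lambda>i. x $ (a + i))"
  by (intro eq_vecI) (auto simp: proj2_def scalar_prod_def if_distrib[of "\<lambda>x. x * _"] cong: if_cong)

lemma mult_incl1:
  "A \<in> carrier_mat r (a + b) \<Longrightarrow> A * incl1 a b = mat r a (\<lambda>(i, j). A $$ (i, j))"
  by (intro eq_matI) (auto simp: incl1_def scalar_prod_def if_distrib[of "\<lambda>x. _ * x"] cong: if_cong)

lemma delta_shift:
  fixes f :: "nat \<Rightarrow> 'a::semiring_1"
  shows "(\<Sum>k = 0..<b. f k * (if j = a + k then 1 else 0)) = (if a \<le> j \<and> j < a + b then f (j - a) else 0)"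
proof (cases "a \<le> j")
  case True
  then have "(\<Sum>k = 0..<b. f k * (if j = a + k then 1 else 0)) = (\<Sum>k = 0..<b. if k = j - a then f k else 0)"
    by (intro sum.cong) auto
  then show ?thesis
    using True by auto
qed (auto intro!: sum.neutral)

lemma mult_proj1:
  "B \<in> carrier_mat r a \<Longrightarrow> B * proj1 a b = mat r (a + b) (\<lambda>(i, j). if j < a then B $$ (i, j) else 0)"
  by (intro eq_matI) (auto simp: proj1_def scalar_prod_def delta_shift[where a = 0, simplified])

lemma mult_proj2:
  "B \<in> carrier_mat r b \<Longrightarrow> B * proj2 a b = mat r (a + b) (\<lambda>(i, j). if j < a then 0 else B $$ (i, j - a))"
  by (intro eq_matI) (auto simp: proj2_def scalar_prod_def delta_shift)

lemma incl1_mult: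
  "B \<in> carrier_mat a c \<Longrightarrow> incl1 a b * B = mat (a + b) c (\<lambda>(i, j). if i < a then B $$ (i, j) else 0)"
  by (intro eq_matI) (auto simp: incl1_def scalar_prod_def if_distrib[of "\<lambda>x. x * _"] cong: if_cong)

lemma incl1_mult_vec:
  "x \<in> carrier_vec a \<Longrightarrow> incl1 a b *\<^sub>v x = vec (a + b) (\<lambda>i. if i < a then x $ i else 0)"
  by (intro eq_vecI) (auto simp: incl1_def scalar_prod_def if_distrib[of "\<lambda>x. x * _"] cong: if_cong)

text \<open>The middle term of the extension with block arrows \<open>[W, \<eta>; 0, V]\<close> splits only if the
  cocycle \<open>\<eta>\<close> is a coboundary.\<close>

lemma Ext1_zero_coboundary:
  fixes V W :: "'k::field rep"
  assumes V: "V \<in> reps n" and W: "W \<in> reps n" and zero: "Ext1_zero n V W"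
    and \<eta>: "\<And>m. 1 \<le> m \<Longrightarrow> m < n \<Longrightarrow> \<eta> m \<in> carrier_mat (dim_at W (Suc m)) (dim_at V m)"
  shows "\<exists>h. (\<forall>m. 1 \<le> m \<and> m \<le> n \<longrightarrow> h m \<in> carrier_mat (dim_at W m) (dim_at V m)) \<and>
    (\<forall>m. 1 \<le> m \<and> m < n \<longrightarrow> h (Suc m) * arrow V m = arrow W m * h m + \<eta> m)"
proof -
  define dW dV where "dW = dim_at W" and "dV = dim_at V"
  define E where "E = Rep (\<lambda>m. dW m + dV m)
    (\<lambda>m. four_block_mat (arrow W m) (\<eta> m) (0\<^sub>m (dV (Suc m)) (dW m)) (arrow V m))"
  define f where "f m = (incl1 (dW m) (dV m) :: 'k mat)" for m
  define g where "g m = (proj2 (dW m) (dV m) :: 'k mat)" for m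
  define p where "p m = (proj1 (dW m) (dV m) :: 'k mat)" for m
  have dE: "dim_at E m = dW m + dV m" for m
    by (simp add: E_def)
  have a: "arrow W m \<in> carrier_mat (dW (Suc m)) (dW m)" "arrow V m \<in> carrier_mat (dV (Suc m)) (dV m)"
    "\<eta> m \<in> carrier_mat (dW (Suc m)) (dV m)"
    if "1 \<le> m" "m < n" for m
    using arrow_carrier[OF V that] arrow_carrier[OF W that] \<eta>[OF that] by (simp_all add: dW_def dV_def)
  have aE: "arrow E m \<in> carrier_mat (dW (Suc m) + dV (Suc m)) (dW m + dV m)" if "1 \<le> m" "m < n" for m
    unfolding E_def rep.sel by (rule four_block_carrier_mat[OF a(1,2)[OF that]])
  have E: "E \<in> reps n"
    using aE by (intro repsI) (simp add: dE)
  have fc: "f m \<in> carrier_mat (dW m + dV m) (dW m)" and gc: "g m \<in> carrier_mat (dV m) (dW m + dV m)"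
    and pc: "p m \<in> carrier_mat (dW m) (dW m + dV m)" for m
    by (simp_all add: f_def g_def p_def)
  have index: "arrow E m $$ (i, j) =
      (if i < dW (Suc m) then if j < dW m then arrow W m $$ (i, j) else \<eta> m $$ (i, j - dW m)
       else if j < dW m then 0 else arrow V m $$ (i - dW (Suc m), j - dW m))"
    if "1 \<le> m" "m < n" "i < dW (Suc m) + dV (Suc m)" "j < dW m + dV m" for m i j
    using a[OF that(1,2)] that(3,4) by (auto simp: E_def)
  have "short_exact n W f E g V"
    unfolding short_exact_def
  proof (intro conjI ballI)
    show "f \<in> homs n W E"
    proof (rule homsI)
      fix m assume m: "1 \<le> m" "m < n"
      show "f (Suc m) * arrow W m = arrow E m * f m"
        unfolding f_def incl1_mult[OF a(1)[OF m]] mult_incl1[OF aE[OF m]]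
        by (intro eq_matI) (auto simp: index[OF m])
    qed (use fc in \<open>simp add: dE dW_def\<close>)
    show "g \<in> homs n E V"
    proof (rule homsI)
      fix m assume m: "1 \<le> m" "m < n"
      show "g (Suc m) * arrow E m = arrow V m * g m"
        unfolding g_def mult_proj2[OF a(2)[OF m]] proj2_mult[OF aE[OF m]]
        by (intro eq_matI) (auto simp: index[OF m])
    qed (use gc in \<open>simp add: dE dV_def\<close>)
    fix m
    show "inj_on ((*\<^sub>v) (f m)) (carrier_vec (dim_at W m))"
    proof (rule inj_onI)
      fix x y assume x: "x \<in> carrier_vec (dim_at W m)" and y: "y \<in> carrier_vec (dim_at W m)"
        and eq: "f m *\<^sub>v x = f m *\<^sub>v y"
      have "x $ i = y $ i" if "i < dim_at W m" for i
        using arg_cong[OF eq, of "\<lambda>v. v $ i"] x y that by (simp add: f_def dW_def incl1_mult_vec)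
      then show "x = y"
        using x y by (intro eq_vecI) auto
    qed
    have "x \<in> (*\<^sub>v) (f m) ` carrier_vec (dW m)" if x: "x \<in> mat_kernel (g m)" for x
    proof -
      have x': "x \<in> carrier_vec (dW m + dV m)" "g m *\<^sub>v x = 0\<^sub>v (dV m)"
        using mat_kernelD[OF gc x] by auto
      have zero: "x $ (dW m + i) = 0" if "i < dV m" for i
        using arg_cong[OF x'(2), of "\<lambda>v. v $ i"] x'(1) that by (simp add: g_def proj2_mult_vec)
      have "x $ i = 0" if "dW m \<le> i" "i < dW m + dV m" for i
        using zero[of "i - dW m"] that by simp
      then have "x = f m *\<^sub>v vec (dW m) (\<lambda>i. x $ i)"
        using x'(1) by (intro eq_vecI) (auto simp: f_def incl1_mult_vec)
      then show ?thesis
        by (rule image_eqI) simp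
    qed
    moreover have "f m *\<^sub>v x \<in> mat_kernel (g m)" if x: "x \<in> carrier_vec (dW m)" for x
    proof (rule mat_kernelI[OF gc])
      show fx: "f m *\<^sub>v x \<in> carrier_vec (dW m + dV m)"
        using mult_mat_vec_carrier[OF fc x] .
      then show "g m *\<^sub>v (f m *\<^sub>v x) = 0\<^sub>v (dV m)"
        using x by (intro eq_vecI) (auto simp: g_def f_def proj2_mult_vec incl1_mult_vec)
    qed
    ultimately show "(*\<^sub>v) (f m) ` carrier_vec (dim_at W m) = mat_kernel (g m)"
      by (auto simp: dW_def)
    have "x \<in> (*\<^sub>v) (g m) ` carrier_vec (dW m + dV m)" if x: "x \<in> carrier_vec (dV m)" for x
    proof (rule image_eqI)
      show "x = g m *\<^sub>v vec (dW m + dV m) (\<lambda>i. x $ (i - dW m))"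
        using x by (intro eq_vecI) (auto simp: g_def proj2_mult_vec)
    qed simp
    moreover have "g m *\<^sub>v x \<in> carrier_vec (dV m)" if "x \<in> carrier_vec (dW m + dV m)" for x
      using mult_mat_vec_carrier[OF gc that] .
    ultimately show "(*\<^sub>v) (g m) ` carrier_vec (dim_at E m) = carrier_vec (dim_at V m)"
      unfolding dE by (auto simp: dV_def)
  qed
  with zero E obtain s where s: "s \<in> homs n V E"
    "\<And>m. 1 \<le> m \<Longrightarrow> m \<le> n \<Longrightarrow> g m * s m = 1\<^sub>m (dV m)"
    unfolding Ext1_zero_def dV_def by fastforce
  have sc: "s m \<in> carrier_mat (dW m + dV m) (dV m)" if "1 \<le> m" "m \<le> n" for m
    using hom_carrier[OF s(1) that] by (simp add: dE dV_def)
  \<comment> \<open>The projection \<open>p\<close> to the \<open>W\<close> block is linear at each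
    vertex, and it fails to commute with the arrows exactly by \<open>\<eta> g\<close>. Composing
    with the section turns this defect into \<open>\<eta>\<close>, so \<open>h = p s\<close> is the
    required cochain.\<close>
  have "p (Suc m) * s (Suc m) * arrow V m = arrow W m * (p m * s m) + \<eta> m" if m: "1 \<le> m" "m < n" for m
  proof -
    have m': "1 \<le> Suc m" "Suc m \<le> n" "m \<le> n"
      using m by auto
    note c = sc[OF m'(1,2)] sc[OF m(1) m'(3)] a[OF m] aE[OF m] pc[of m] pc[of "Suc m"] gc[of m]
    have "p (Suc m) * s (Suc m) * arrow V m = p (Suc m) * (arrow E m * s m)"
      using assoc_mult_mat[OF c(8) c(1) c(4)] hom_arrow[OF s(1) m] by simp
    also have "\<dots> = (p (Suc m) * arrow E m) * s m"
      using assoc_mult_mat[OF c(8) c(6) c(2)] by simp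
    also have "p (Suc m) * arrow E m = arrow W m * p m + \<eta> m * g m"
      unfolding p_def g_def proj1_mult[OF aE[OF m]] mult_proj1[OF a(1)[OF m]] mult_proj2[OF a(3)[OF m]]
      by (intro eq_matI) (auto simp: index[OF m])
    also have "\<dots> * s m = arrow W m * p m * s m + \<eta> m * g m * s m"
      using c by (intro add_mult_distrib_mat) auto
    also have "\<dots> = arrow W m * (p m * s m) + \<eta> m * (g m * s m)"
      using assoc_mult_mat[OF c(3) c(7) c(2)] assoc_mult_mat[OF c(5) c(9) c(2)] by simp
    also have "\<dots> = arrow W m * (p m * s m) + \<eta> m"
      using right_mult_one_mat[OF c(5)] by (simp add: s(2)[OF m(1) m'(3)])
    finally show ?thesis .
  qed
  moreover have "p m * s m \<in> carrier_mat (dW m) (dV m)" if "1 \<le> m" "m \<le> n" for m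
    using pc[of m] sc[OF that] by simp
  ultimately show ?thesis
    unfolding dW_def dV_def by (intro exI[of _ "\<lambda>m. p m * s m"]) simp
qed

section \<open>Hom and Ext between interval modules\<close>

lemma dim_interval [simp]: "dim_at (interval_module i j) m = (if i < m \<and> m \<le> j then 1 else 0)"
  by (simp add: interval_module_def)

lemma arrow_interval: "i < m \<Longrightarrow> m < j \<Longrightarrow> arrow (interval_module i j) m = 1\<^sub>m 1"
  by (simp add: interval_module_def)

lemma arrow_interval_zero:
  "\<not> (i < m \<and> m < j) \<Longrightarrow> arrow (interval_module i j) m =
    0\<^sub>m (if i < Suc m \<and> Suc m \<le> j then 1 else 0) (if i < m \<and> m \<le> j then 1 else 0)"
  by (auto simp: interval_module_def)

lemma interval_reps [simp]: "interval_module i j \<in> reps n"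
  by (auto simp: reps_def interval_module_def)

text \<open>The interval module is generated by its basis vector at \<open>i + 1\<close>. A morphism
  out of it is a sequence of vectors that follows the arrows of \<open>E\<close> and dies after
  \<open>j\<close>; these vectors are the columns of the matrices.\<close>

lemma interval_hom:
  fixes E :: "'k::field rep"
  assumes E: "E \<in> reps n" and x: "\<And>m. i < m \<Longrightarrow> m \<le> j \<Longrightarrow> m \<le> n \<Longrightarrow> x m \<in> carrier_vec (dim_at E m)"
    and step: "\<And>m. i < m \<Longrightarrow> m < j \<Longrightarrow> m < n \<Longrightarrow> arrow E m *\<^sub>v x m = x (Suc m)"
    and last: "i < j \<Longrightarrow> j < n \<Longrightarrow> arrow E j *\<^sub>v x j = 0\<^sub>v (dim_at E (Suc j))"
  shows "(\<lambda>m. if i < m \<and> m \<le> j then mat_of_cols (dim_at E m) [x m] else 0\<^sub>m (dim_at E m) 0)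
    \<in> homs n (interval_module i j) E" (is "?f \<in> _")
proof (rule homsI)
  let ?V = "interval_module i j :: 'k rep"
  show c: "?f m \<in> carrier_mat (dim_at E m) (dim_at ?V m)" for m
    by auto
  fix m assume m: "1 \<le> m" "m < n"
  have c': "?f (Suc m) * arrow ?V m \<in> carrier_mat (dim_at E (Suc m)) (dim_at ?V m)"
    "arrow E m * ?f m \<in> carrier_mat (dim_at E (Suc m)) (dim_at ?V m)"
    using mult_carrier_mat[OF c arrow_carrier[OF interval_reps m]] mult_carrier_mat[OF arrow_carrier[OF E m] c]
    by blast+
  show "?f (Suc m) * arrow ?V m = arrow E m * ?f m"
  proof (cases "i < m \<and> m \<le> j")
    case False
    then show ?thesis
      by (intro empty_mat_eq[OF c']) auto
  next
    case True
    then have xm: "x m \<in> carrier_vec (dim_at E m)"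
      using x m by simp
    have eq: "arrow E m * ?f m = mat_of_cols (dim_at E (Suc m)) [arrow E m *\<^sub>v x m]"
      using mult_mat_of_col[OF arrow_carrier[OF E m] xm] True by simp
    show ?thesis
    proof (cases "m = j")
      case True
      have "?f (Suc m) * arrow ?V m = 0\<^sub>m (dim_at E (Suc m)) 1"
        using True \<open>i < m \<and> m \<le> j\<close> by (simp add: arrow_interval_zero)
      moreover have "arrow E m * ?f m = 0\<^sub>m (dim_at E (Suc m)) 1"
        unfolding eq using last True m \<open>i < m \<and> m \<le> j\<close>
        by (intro eq_matI) (auto simp: mat_of_cols_index)
      ultimately show ?thesis
        using True by simp
    next
      case False
      then have "i < m" "m < j"
        using True by auto
      then show ?thesis
        using eq step[of m] m right_mult_one_mat[of "mat_of_cols (dim_at E (Suc m)) [x (Suc m)]" "dim_at E (Suc m)" 1]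
        by (simp add: arrow_interval)
    qed
  qed
qed

text \<open>The morphism factors through \<open>M(i,l)\<close>, which is a quotient of
  \<open>M(i,j)\<close> and a submodule of \<open>M(k,l)\<close>.\<close>

lemma Hom_nonzero_interval:
  assumes "k \<le> i" "i < l" "l \<le> j" "j \<le> n"
  shows "\<not> Hom_zero n (interval_module i j) (interval_module k l :: 'k::field rep)"
proof
  let ?V = "interval_module i j :: 'k rep" and ?W = "interval_module k l :: 'k rep"
  \<comment> \<open>Beyond \<open>l\<close> the target has dimension 0, so the vector there has to
    be the empty one.\<close>
  let ?x = "\<lambda>m. if m \<le> l then unit_vec 1 0 else 0\<^sub>v 0 :: 'k vec"
  let ?f = "\<lambda>m. if i < m \<and> m \<le> j then mat_of_cols (dim_at ?W m) [?x m] else 0\<^sub>m (dim_at ?W m) 0"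
  assume zero: "Hom_zero n ?V ?W"
  have "?f \<in> homs n ?V ?W"
  proof (rule interval_hom)
    show "?x m \<in> carrier_vec (dim_at ?W m)" if "i < m" "m \<le> j" for m
      using that assms by auto
    show "arrow ?W m *\<^sub>v ?x m = ?x (Suc m)" if "i < m" "m < j" for m
    proof (cases "m < l")
      case True
      then show ?thesis
        using that assms by (simp add: arrow_interval)
    next
      case False
      then show ?thesis
        using that assms by (intro eq_vecI) (auto simp: arrow_interval_zero)
    qed
    show "arrow ?W j *\<^sub>v ?x j = 0\<^sub>v (dim_at ?W (Suc j))"
      using assms by (intro eq_vecI) (auto simp: arrow_interval_zero)
  qed simp
  from Hom_zeroD[OF zero this, of "Suc i"] assms
  have "mat_of_cols 1 [unit_vec 1 0 :: 'k vec] = 0\<^sub>m 1 1"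
    by simp
  then show False
    unfolding mat_of_col_unit_vec by (metis index_one_mat(1) index_zero_mat(1) less_one zero_neq_one)
qed

text \<open>On the common support a morphism is one constant scalar. If that support is nonempty
  then \<open>i < l\<close>, so the assumption leaves \<open>i < k\<close> or \<open>j < l\<close>.
  In the first case the square at \<open>k\<close> forces the scalar to be zero because the target
  vanishes at \<open>k\<close>; in the second the square at \<open>j\<close> does, because the
  source vanishes at \<open>j + 1\<close>.\<close>

lemma Hom_zero_interval:
  assumes "\<not> (k \<le> i \<and> i < l \<and> l \<le> j)" "i < j" "k < l" "j \<le> n" "l \<le> n"
  shows "Hom_zero n (interval_module i j) (interval_module k l :: 'k::field rep)"
  unfolding Hom_zero_def
proof (intro ballI)
  let ?V = "interval_module i j :: 'k rep" and ?W = "interval_module k l :: 'k rep"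
  fix f m assume f: "f \<in> homs n ?V ?W" and "m \<in> {1..n}"
  then have m: "1 \<le> m" "m \<le> n" by auto
  show "f m = 0\<^sub>m (dim_at ?W m) (dim_at ?V m)"
  proof (cases "i < m \<and> m \<le> j \<and> k < m \<and> m \<le> l")
    case False
    then show ?thesis
      by (intro empty_mat_eq[OF hom_carrier[OF f m]]) auto
  next
    case True
    have c: "f m \<in> carrier_mat 1 1" if "i < m" "m \<le> j" "k < m" "m \<le> l" for m
      using hom_carrier[OF f, of m] that assms by simp
    have eq: "f (Suc m) = f m" if "i < m" "m < j" "k < m" "m < l" for m
      using hom_arrow[OF f, of m] that assms c[of m] c[of "Suc m"] by (simp add: arrow_interval)
    have "f m = 0\<^sub>m 1 1"
    proof (cases "i < k")
      case True
      have "f (Suc k) = f (Suc k) * arrow ?V k"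
        using c[of "Suc k"] True \<open>i < m \<and> _\<close> by (simp add: arrow_interval)
      also have "\<dots> = arrow ?W k * f k"
        using hom_arrow[OF f, of k] True assms by simp
      also have "\<dots> = 0\<^sub>m 1 1"
        using hom_carrier[OF f, of k] True assms \<open>i < m \<and> _\<close>
        by (simp add: arrow_interval_zero)
      finally have fk: "f (Suc k) = 0\<^sub>m 1 1" .
      have "Suc k \<le> m" using \<open>i < m \<and> _\<close> by simp
      then show ?thesis
        using \<open>i < m \<and> _\<close>
      proof (induction m rule: dec_induct)
        case (step m)
        then show ?case
          using eq[of m] True by simp
      qed (use fk in simp)
    next
      case False
      then have "j < l"
        using assms True by auto
      have "f j = arrow ?W j * f j"
        using c[of j] True \<open>j < l\<close> by (simp add: arrow_interval)
      also have "\<dots> = f (Suc j) * arrow ?V j"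
        using hom_arrow[OF f, of j] True assms \<open>j < l\<close> by simp
      also have "\<dots> = 0\<^sub>m 1 1"
        using hom_carrier[OF f, of "Suc j"] True assms \<open>j < l\<close>
        by (simp add: arrow_interval_zero)
      finally have fj: "f j = 0\<^sub>m 1 1" .
      have "m \<le> j" using True by simp
      then show ?thesis
        using True
      proof (induction m rule: inc_induct)
        case (step m)
        then show ?case
          using eq[of m] \<open>j < l\<close> by simp
      qed (use fj in simp)
    qed
    then show ?thesis
      using True by simp
  qed
qed

text \<open>The cocycle is the identity on the single arrow from \<open>j\<close> to
  \<open>j + 1\<close>, where the support of the first module ends inside that of the second. A
  cochain \<open>h\<close> bounding it is zero at \<open>k + 1\<close>, because the second module
  vanishes at \<open>k\<close>, hence zero up to \<open>j\<close>; its equation at \<open>j\<close>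
  then reads 0 = 1.\<close>

lemma Ext1_nonzero_interval:
  assumes "i < k" "k \<le> j" "j < l" "l \<le> n"
  shows "\<not> Ext1_zero n (interval_module i j) (interval_module k l :: 'k::field rep)"
proof
  let ?V = "interval_module i j :: 'k rep" and ?W = "interval_module k l :: 'k rep"
  let ?\<eta> = "\<lambda>m. if m = j then 1\<^sub>m 1 else 0\<^sub>m (dim_at ?W (Suc m)) (dim_at ?V m)"
  assume "Ext1_zero n ?V ?W"
  then have "\<exists>h. (\<forall>m. 1 \<le> m \<and> m \<le> n \<longrightarrow> h m \<in> carrier_mat (dim_at ?W m) (dim_at ?V m)) \<and>
    (\<forall>m. 1 \<le> m \<and> m < n \<longrightarrow> h (Suc m) * arrow ?V m = arrow ?W m * h m + ?\<eta> m)"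
    by (rule Ext1_zero_coboundary[OF interval_reps interval_reps]) (use assms in auto)
  then obtain h where h: "\<And>m. 1 \<le> m \<Longrightarrow> m \<le> n \<Longrightarrow> h m \<in> carrier_mat (dim_at ?W m) (dim_at ?V m)"
    "\<And>m. 1 \<le> m \<Longrightarrow> m < n \<Longrightarrow> h (Suc m) * arrow ?V m = arrow ?W m * h m + ?\<eta> m"
    by blast
  have c: "h m \<in> carrier_mat 1 1" if "k < m" "m \<le> j" for m
    using h(1)[of m] that assms by simp
  have h0: "h m = 0\<^sub>m 1 1" if "k < m" "m \<le> j" for m
  proof -
    have "Suc k \<le> m" using that by simp
    then show ?thesis
      using that
    proof (induction m rule: dec_induct)
      case base
      have "h (Suc k) = h (Suc k) * arrow ?V k"
        using c[OF base] base assms by (simp add: arrow_interval)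
      also have "\<dots> = arrow ?W k * h k + ?\<eta> k"
        using h(2)[of k] base assms by simp
      also have "\<dots> = 0\<^sub>m 1 1"
        using h(1)[of k] base assms by (simp add: arrow_interval_zero)
      finally show ?case .
    next
      case (step m)
      then have "h (Suc m) = h m"
        using h(2)[of m] assms c[of m] c[of "Suc m"] by (simp add: arrow_interval)
      then show ?case
        using step by simp
    qed
  qed
  have "arrow ?W j * h j = 0\<^sub>m 1 1"
  \<comment> \<open>For \<open>k = j\<close> the common support is empty and \<open>h j\<close> has
    no rows, so \<open>h0\<close> says nothing about it.\<close>
  proof (cases "k = j")
    case True
    then show ?thesis
      using h(1)[of j] assms by (simp add: arrow_interval_zero)
  next
    case False
    then show ?thesis
      using h0[of j] assms by (simp add: arrow_interval)
  qed
  moreover have "h (Suc j) * arrow ?V j = 0\<^sub>m 1 1"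
    using h(1)[of "Suc j"] assms by (simp add: arrow_interval_zero)
  ultimately have "0\<^sub>m 1 1 = (1\<^sub>m 1 :: 'k mat)"
    using h(2)[of j] assms by simp
  then show False
    by (metis index_one_mat(1) index_zero_mat(1) less_one zero_neq_one)
qed

section \<open>Composites of arrows, and splitting over interval modules\<close>

fun transport :: "'k::field rep \<Rightarrow> nat \<Rightarrow> nat \<Rightarrow> 'k mat" where
  "transport V a 0 = 1\<^sub>m (dim_at V a)"
| "transport V a (Suc t) = arrow V (a + t) * transport V a t"

lemma transport_carrier:
  assumes "V \<in> reps n" "1 \<le> a" "a + t \<le> n"
  shows "transport V a t \<in> carrier_mat (dim_at V (a + t)) (dim_at V a)"
  using assms(3)
proof (induction t)
  case (Suc t)
  then show ?case
    using mult_carrier_mat[OF arrow_carrier[OF assms(1), of "a + t"] Suc.IH] assms(2) by simp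
qed simp

lemma transport_Suc_vec:
  assumes "V \<in> reps n" "1 \<le> a" "a + t < n" "x \<in> carrier_vec (dim_at V a)"
  shows "arrow V (a + t) *\<^sub>v (transport V a t *\<^sub>v x) = transport V a (Suc t) *\<^sub>v x"
  using assms by (simp add: assoc_mult_mat_vec[OF arrow_carrier transport_carrier])

lemma transport_add:
  assumes "V \<in> reps n" "1 \<le> a" "a + s + t \<le> n"
  shows "transport V a (s + t) = transport V (a + s) t * transport V a s"
  using assms(3)
proof (induction t)
  case 0
  then show ?case
    using transport_carrier[OF assms(1,2), of s] by simp
next
  case (Suc t)
  then show ?case
    using assoc_mult_mat[OF arrow_carrier[OF assms(1), of "a + s + t"] transport_carrier[OF assms(1), of "a + s" t]
        transport_carrier[OF assms(1,2), of s]] assms(2)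
    by (simp add: add.assoc)
qed

lemma transport_hom:
  assumes V: "V \<in> reps n" and W: "W \<in> reps n" and f: "f \<in> homs n V W"
    and a: "1 \<le> a" "a + t \<le> n" and x: "x \<in> carrier_vec (dim_at V a)"
  shows "f (a + t) *\<^sub>v (transport V a t *\<^sub>v x) = transport W a t *\<^sub>v (f a *\<^sub>v x)"
  using a(2)
proof (induction t)
  case 0
  then show ?case
    using mult_mat_vec_carrier[OF hom_carrier[OF f a(1)] x] x by simp
next
  case (Suc t)
  have fx: "f a *\<^sub>v x \<in> carrier_vec (dim_at W a)"
    using mult_mat_vec_carrier[OF hom_carrier[OF f a(1)] x] Suc.prems by simp
  have "f (a + Suc t) *\<^sub>v (transport V a (Suc t) *\<^sub>v x)
      = f (Suc (a + t)) *\<^sub>v (arrow V (a + t) *\<^sub>v (transport V a t *\<^sub>v x))"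
    using transport_Suc_vec[OF V a(1) _ x, of t] Suc.prems by simp
  also have "\<dots> = arrow W (a + t) *\<^sub>v (f (a + t) *\<^sub>v (transport V a t *\<^sub>v x))"
    using hom_arrow_vec[OF V W f, of "a + t"] mult_mat_vec_carrier[OF transport_carrier[OF V a(1), of t] x]
      Suc.prems a(1) by simp
  also have "\<dots> = transport W a (Suc t) *\<^sub>v (f a *\<^sub>v x)"
    using Suc transport_Suc_vec[OF W a(1) _ fx, of t] by simp
  finally show ?case .
qed

lemma transport_interval:
  assumes "i < a" "a + t \<le> j"
  shows "transport (interval_module i j) a t = 1\<^sub>m 1"
  using assms(2)
proof (induction t)
  case (Suc t)
  then show ?case
    using assms(1) by (simp add: arrow_interval)
qed (use assms in simp)

text \<open>A section out of an interval module amounts to a lift \<open>e\<close> of its generator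
  that is killed on reaching \<open>j + 1\<close>; for \<open>j = n\<close> there is no such vertex
  and every lift will do.\<close>

lemma interval_section:
  fixes E :: "'k::field rep"
  assumes E: "E \<in> reps n" and ij: "i < j" "j \<le> n" and g: "g \<in> homs n E (interval_module i j)"
    and e: "e \<in> carrier_vec (dim_at E (Suc i))" "g (Suc i) *\<^sub>v e = unit_vec 1 0"
    and kill: "j < n \<Longrightarrow> transport E (Suc i) (j - i) *\<^sub>v e = 0\<^sub>v (dim_at E (Suc j))"
  shows "\<exists>s\<in>homs n (interval_module i j) E. \<forall>m\<in>{1..n}. g m * s m = 1\<^sub>m (dim_at (interval_module i j :: 'k rep) m)"
proof -
  let ?V = "interval_module i j :: 'k rep"
  define x where "x m = transport E (Suc i) (m - Suc i) *\<^sub>v e" for m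
  have x: "x m \<in> carrier_vec (dim_at E m)" if "i < m" "m \<le> n" for m
    unfolding x_def
    using mult_mat_vec_carrier[OF transport_carrier[OF E, of "Suc i" "m - Suc i"] e(1)] that by simp
  have step: "arrow E m *\<^sub>v x m = transport E (Suc i) (m - i) *\<^sub>v e" if "i < m" "m < n" for m
  proof -
    have "m - i = Suc (m - Suc i)"
      using that by simp
    then show ?thesis
      using transport_Suc_vec[OF E, of "Suc i" "m - Suc i", OF _ _ e(1)] that unfolding x_def by simp
  qed
  have gx: "g m *\<^sub>v x m = unit_vec 1 0" if "i < m" "m \<le> j" for m
  proof -
    have "g m *\<^sub>v x m = transport ?V (Suc i) (m - Suc i) *\<^sub>v (g (Suc i) *\<^sub>v e)"
      using transport_hom[OF E interval_reps g, of "Suc i" "m - Suc i", OF _ _ e(1)] that ij unfolding x_def by simp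
    then show ?thesis
      using that e(2) by (simp add: transport_interval)
  qed
  show ?thesis
  proof (rule bexI[OF _ interval_hom[OF E, of i j x]])
    show "\<forall>m\<in>{1..n}. g m * (if i < m \<and> m \<le> j then mat_of_cols (dim_at E m) [x m] else 0\<^sub>m (dim_at E m) 0)
        = 1\<^sub>m (dim_at ?V m)"
    proof
      fix m assume "m \<in> {1..n}"
      then have m: "1 \<le> m" "m \<le> n" by auto
      show "g m * (if i < m \<and> m \<le> j then mat_of_cols (dim_at E m) [x m] else 0\<^sub>m (dim_at E m) 0) = 1\<^sub>m (dim_at ?V m)"
        using mult_mat_of_col[OF hom_carrier[OF g m] x] gx[of m] hom_carrier[OF g m] m mat_of_col_unit_vec
        by (cases "i < m \<and> m \<le> j") (auto intro!: eq_matI)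
    qed
  qed (use x step kill ij in \<open>auto simp: x_def\<close>)
qed

text \<open>The obstruction to using an arbitrary lift \<open>e\<close> is its image
  \<open>y\<close> at \<open>j + 1\<close>, which lies in the kernel of \<open>g\<close> and so
  comes from some \<open>w\<close> in the submodule. Either \<open>w\<close> is zero, or it can be
  pulled back to \<open>i + 1\<close> and subtracted from \<open>e\<close>.\<close>

lemma Ext1_zero_interval:
  assumes no: "\<not> (i < k \<and> k \<le> j \<and> j < l)" and ij: "i < j" "j \<le> n" and kl: "k < l" "l \<le> n"
  shows "Ext1_zero n (interval_module i j) (interval_module k l :: 'k::field rep)"
  unfolding Ext1_zero_def
proof (intro ballI allI impI)
  let ?V = "interval_module i j :: 'k rep" and ?W = "interval_module k l :: 'k rep"
  fix E f g assume E: "E \<in> reps n" and ex: "short_exact n ?W f E g ?V"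
  note f = short_exactD(1)[OF ex] and g = short_exactD(2)[OF ex]
  have i: "1 \<le> Suc i" "Suc i \<le> n"
    using ij by auto
  have "unit_vec 1 0 \<in> (*\<^sub>v) (g (Suc i)) ` carrier_vec (dim_at E (Suc i))"
    using short_exactD(5)[OF ex i] ij by simp
  then obtain e where e: "e \<in> carrier_vec (dim_at E (Suc i))" "g (Suc i) *\<^sub>v e = unit_vec 1 0"
    by auto
  have "\<exists>e \<in> carrier_vec (dim_at E (Suc i)). g (Suc i) *\<^sub>v e = unit_vec 1 0 \<and>
    (j < n \<longrightarrow> transport E (Suc i) (j - i) *\<^sub>v e = 0\<^sub>v (dim_at E (Suc j)))"
  proof (cases "j < n")
    case False
    then show ?thesis
      using e by blast
  next
    case True
    define y where "y = transport E (Suc i) (j - i) *\<^sub>v e"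
    have t: "transport E (Suc i) (j - i) \<in> carrier_mat (dim_at E (Suc j)) (dim_at E (Suc i))"
      using transport_carrier[OF E i(1), of "j - i"] ij True by simp
    have y: "y \<in> carrier_vec (dim_at E (Suc j))"
      unfolding y_def by (rule mult_mat_vec_carrier[OF t e(1)])
    have j: "1 \<le> Suc j" "Suc j \<le> n"
      using True by auto
    have "y \<in> (*\<^sub>v) (f (Suc j)) ` carrier_vec (dim_at ?W (Suc j))"
      unfolding short_exactD(4)[OF ex j]
      by (rule mat_kernelI[OF hom_carrier[OF g j] y]) (use hom_carrier[OF g j] in \<open>auto intro!: eq_vecI\<close>)
    then obtain w where w: "w \<in> carrier_vec (dim_at ?W (Suc j))" "f (Suc j) *\<^sub>v w = y"
      by blast
    show ?thesis
    proof (cases "k < Suc j \<and> Suc j \<le> l")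
      case False
      then have "w = 0\<^sub>v 0"
        using w by auto
      then have "y = 0\<^sub>v (dim_at E (Suc j))"
        using w(2) hom_carrier[OF f j] False by (auto intro!: eq_vecI)
      then show ?thesis
        using e by (auto simp: y_def)
    next
      case True
      \<comment> \<open>With \<open>k \<le> j < l\<close>, the excluded case leaves
        \<open>k \<le> i\<close>. The arrows of the submodule from \<open>i + 1\<close> to
        \<open>j + 1\<close> are then identities, so the same vector \<open>w\<close> may be read at
        \<open>i + 1\<close>.\<close>
      then have kij: "k \<le> i" "j < l"
        using no by auto
      then have w': "w \<in> carrier_vec (dim_at ?W (Suc i))" "dim_at ?V (Suc i) = 1"
        using w(1) ij True by auto
      note fi = hom_carrier[OF f i] and gi = hom_carrier[OF g i]
      have fw: "f (Suc i) *\<^sub>v w \<in> carrier_vec (dim_at E (Suc i))"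
        by (rule mult_mat_vec_carrier[OF fi w'(1)])
      have "f (Suc i) *\<^sub>v w \<in> mat_kernel (g (Suc i))"
        using short_exactD(4)[OF ex i] w'(1) by blast
      then have "g (Suc i) *\<^sub>v (f (Suc i) *\<^sub>v w) = 0\<^sub>v 1"
        using mat_kernelD[OF gi] w'(2) by simp
      then have 1: "g (Suc i) *\<^sub>v (e - f (Suc i) *\<^sub>v w) = unit_vec 1 0"
        using mult_minus_distrib_mat_vec[OF gi e(1) fw] e(2) by simp
      have "transport E (Suc i) (j - i) *\<^sub>v (f (Suc i) *\<^sub>v w) = f (Suc j) *\<^sub>v (transport ?W (Suc i) (j - i) *\<^sub>v w)"
        using transport_hom[OF interval_reps E f i(1) _ w'(1), of "j - i"] ij j by simp
      also have "\<dots> = y"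
        using kij ij w w'(1) by (simp add: transport_interval)
      finally have "transport E (Suc i) (j - i) *\<^sub>v (e - f (Suc i) *\<^sub>v w) = 0\<^sub>v (dim_at E (Suc j))"
        using mult_minus_distrib_mat_vec[OF t e(1) fw] y by (simp add: y_def)
      then show ?thesis
        using 1 e(1) fw by (intro bexI[of _ "e - f (Suc i) *\<^sub>v w"]) auto
    qed
  qed
  then show "\<exists>s\<in>homs n ?V E. \<forall>m\<in>{1..n}. g m * s m = 1\<^sub>m (dim_at ?V m)"
    using interval_section[OF E ij g] by blast
qed

section \<open>Interval modules as the indecomposable representations\<close>

lemma subspaceI:
  fixes U :: "'k::field vec set"
  assumes "U \<subseteq> carrier_vec d" "0\<^sub>v d \<in> U" "\<And>x y. x \<in> U \<Longrightarrow> y \<in> U \<Longrightarrow> x + y \<in> U"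
    "\<And>c x. x \<in> U \<Longrightarrow> c \<cdot>\<^sub>v x \<in> U"
  shows "VectorSpace.subspace class_ring U (module_vec TYPE('k) d)"
  using assms by (intro VectorSpace.subspace.intro submodule.intro vec_vs vec_module)
    (simp_all add: module_vec_simps)

lemma subspaceD:
  fixes U :: "'k::field vec set"
  assumes "VectorSpace.subspace class_ring U (module_vec TYPE('k) d)"
  shows "U \<subseteq> carrier_vec d" "0\<^sub>v d \<in> U" "x \<in> U \<Longrightarrow> c \<cdot>\<^sub>v x \<in> U"
proof -
  interpret submodule class_ring U "module_vec TYPE('k) d"
    using VectorSpace.subspace.submod[OF assms] .
  show "U \<subseteq> carrier_vec d" "0\<^sub>v d \<in> U" "x \<in> U \<Longrightarrow> c \<cdot>\<^sub>v x \<in> U"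
    using subset zero_closed smult_closed[of c x] by (simp_all add: module_vec_simps class_ring_simps)
qed

lemma carrier_vec_0: "carrier_vec 0 = {0\<^sub>v 0}"
proof -
  have "x = 0\<^sub>v 0" if "x \<in> carrier_vec 0" for x :: "'a vec"
    using that by (intro eq_vecI) simp_all
  then show ?thesis
    by fastforce
qed

lemma dim_interval_eq_0: "dim_at (interval_module i j) m = 0 \<longleftrightarrow> \<not> (i < m \<and> m \<le> j)"
  by simp

text \<open>A nonzero subspace at the first support vertex is the whole line, and the identity
  arrows carry it to every later one.\<close>

lemma interval_subrep_full:
  fixes U :: "nat \<Rightarrow> 'k::field vec set"
  assumes U: "subrep n (interval_module i j) U" and ij: "j \<le> n" and U0: "U (Suc i) \<noteq> {0\<^sub>v 1}"
    and m: "i < m" "m \<le> j"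
  shows "U m = carrier_vec 1"
proof -
  let ?V = "interval_module i j :: 'k rep"
  have sub: "VectorSpace.subspace class_ring (U m) (module_vec TYPE('k) 1)" if "i < m" "m \<le> j" for m
  proof -
    have "m \<in> {1..n}"
      using that ij by simp
    then have "VectorSpace.subspace class_ring (U m) (module_vec TYPE('k) (dim_at ?V m))"
      using U unfolding subrep_def by blast
    then show ?thesis
      using that by simp
  qed
  have "Suc i \<le> m" using m by simp
  then show ?thesis
    using m
  proof (induction m rule: dec_induct)
    case base
    note s = subspaceD[OF sub[OF base]]
    obtain x where x: "x \<in> U (Suc i)" "x \<noteq> 0\<^sub>v 1"
      using s(2) U0 by blast
    then have xc: "x \<in> carrier_vec 1"
      using s(1) by blast
    have "x $ 0 \<noteq> 0"
      using x(2) xc by (auto intro!: eq_vecI)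
    show ?case
    proof (rule antisym[OF s(1)], rule subsetI)
      fix y :: "'k vec" assume y: "y \<in> carrier_vec 1"
      have "y = (y $ 0 / x $ 0) \<cdot>\<^sub>v x"
        using xc y \<open>x $ 0 \<noteq> 0\<close> by (intro eq_vecI) auto
      then show "y \<in> U (Suc i)"
        using s(3)[OF x(1), of "y $ 0 / x $ 0"] by simp
    qed
  next
    case (step m)
    have "m \<in> {1..<n}"
      using step ij by simp
    then have "(*\<^sub>v) (arrow ?V m) ` U m \<subseteq> U (Suc m)"
      using U unfolding subrep_def Suc_eq_plus1 by blast
    moreover have "(*\<^sub>v) (arrow ?V m) ` U m = carrier_vec 1"
      using step by (simp add: arrow_interval)
    ultimately show ?case
      using subspaceD(1)[OF sub[OF step.prems]] by blast
  qed
qed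

text \<open>At \<open>i + 1\<close> one of the two summands is nonzero; it then fills the whole
  support, leaving zero for the other.\<close>

lemma indecomposable_interval:
  assumes "i < j" "j \<le> n"
  shows "indecomposable n (interval_module i j :: 'k::field rep)"
  unfolding indecomposable_def
proof (intro conjI allI impI; (elim conjE)?)
  let ?V = "interval_module i j :: 'k rep"
  show "?V \<in> reps n" by simp
  show "\<exists>m\<in>{1..n}. dim_at ?V m \<noteq> 0"
    using assms by (intro bexI[of _ j]) auto
  fix U W assume U: "subrep n ?V U" and W: "subrep n ?V W"
    and sum: "\<forall>m\<in>{1..n}. {u + w |u w. u \<in> U m \<and> w \<in> W m} = carrier_vec (dim_at ?V m) \<and> U m \<inter> W m = {0\<^sub>v (dim_at ?V m)}"
  have sub: "X m \<subseteq> carrier_vec (dim_at ?V m)" "0\<^sub>v (dim_at ?V m) \<in> X m" if "subrep n ?V X" "m \<in> {1..n}" for X m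
    using that subspaceD(1,2)[of "X m" "dim_at ?V m"] unfolding subrep_def by blast+
  have zero: "Y m = {0\<^sub>v (dim_at ?V m)}"
    if X: "subrep n ?V X" "X (Suc i) \<noteq> {0\<^sub>v 1}" and Y: "subrep n ?V Y" and m: "m \<in> {1..n}"
      and int: "X m \<inter> Y m = {0\<^sub>v (dim_at ?V m)}" for X Y m
  proof (cases "i < m \<and> m \<le> j")
    case True
    then have "X m = carrier_vec 1"
      using interval_subrep_full[OF X(1) assms(2) X(2)] by blast
    then have "Y m \<subseteq> X m"
      using sub(1)[OF Y m] True by simp
    then show ?thesis
      using int by blast
  next
    case False
    then have d0: "dim_at ?V m = 0"
      using dim_interval_eq_0 by blast
    show ?thesis
      using sub[OF Y m] unfolding d0 carrier_vec_0 by blast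
  qed
  show "(\<forall>m\<in>{1..n}. U m = {0\<^sub>v (dim_at ?V m)}) \<or> (\<forall>m\<in>{1..n}. W m = {0\<^sub>v (dim_at ?V m)})"
  proof (cases "U (Suc i) = {0\<^sub>v 1}")
    case False
    then show ?thesis
      using zero[OF U _ W] sum by blast
  next
    case True
    have "W (Suc i) \<noteq> {0\<^sub>v 1}"
    proof
      assume "W (Suc i) = {0\<^sub>v 1}"
      moreover have "{u + w |u w. u \<in> U (Suc i) \<and> w \<in> W (Suc i)} = (carrier_vec 1 :: 'k vec set)"
        using bspec[OF sum, of "Suc i"] assms by simp
      ultimately have "carrier_vec 1 = {0\<^sub>v 1 :: 'k vec}"
        using True by auto
      then have "unit_vec 1 0 = (0\<^sub>v 1 :: 'k vec)"
        by (metis singletonD unit_vec_carrier)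
      then show False
        by simp
    qed
    then show ?thesis
      using zero[OF W _ U] sum by blast
  qed
qed

text \<open>Each \<open>u m\<close> is a basis of a one-dimensional space with
  \<open>\<rho> m\<close> as dual coordinate, so the column \<open>u m\<close> and the row
  \<open>\<rho> m\<close> are inverse matrices.\<close>

lemma interval_if_split_off:
  fixes V :: "'k::field rep"
  assumes V: "V \<in> reps n" and ij: "i < j" "j \<le> n"
    and u: "\<And>m. i < m \<Longrightarrow> m \<le> j \<Longrightarrow> u m \<in> carrier_vec (dim_at V m)"
    and \<rho>: "\<And>m. i < m \<Longrightarrow> m \<le> j \<Longrightarrow> \<rho> m \<in> carrier_vec (dim_at V m)"
    and ustep: "\<And>m. i < m \<Longrightarrow> m < j \<Longrightarrow> arrow V m *\<^sub>v u m = u (Suc m)"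
      "j < n \<Longrightarrow> arrow V j *\<^sub>v u j = 0\<^sub>v (dim_at V (Suc j))"
    and \<rho>u: "\<And>m. i < m \<Longrightarrow> m \<le> j \<Longrightarrow> \<rho> m \<bullet> u m = 1"
    and span: "\<And>m x. i < m \<Longrightarrow> m \<le> j \<Longrightarrow> x \<in> carrier_vec (dim_at V m) \<Longrightarrow> x = (\<rho> m \<bullet> x) \<cdot>\<^sub>v u m"
    and outside: "\<And>m. 1 \<le> m \<Longrightarrow> m \<le> n \<Longrightarrow> \<not> (i < m \<and> m \<le> j) \<Longrightarrow> dim_at V m = 0"
  shows "isomorphic n (interval_module i j) V"
proof (rule isomorphicI[OF interval_reps V interval_hom[OF V]])
  let ?f = "\<lambda>m. if i < m \<and> m \<le> j then mat_of_cols (dim_at V m) [u m] else 0\<^sub>m (dim_at V m) 0"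
  let ?g = "\<lambda>m. if i < m \<and> m \<le> j then mat_of_row (\<rho> m) else 0\<^sub>m 0 (dim_at V m)"
  show "?g m \<in> carrier_mat (dim_at (interval_module i j :: 'k rep) m) (dim_at V m)" for m
    using \<rho>[of m] mat_of_row_carrier(1)[of "\<rho> m" "dim_at V m"] by auto
  show "?g m * ?f m = 1\<^sub>m (dim_at (interval_module i j :: 'k rep) m)" for m
  proof (cases "i < m \<and> m \<le> j")
    case True
    have "mat_of_row (\<rho> m) * mat_of_cols (dim_at V m) [u m] = 1\<^sub>m 1"
      using \<rho>u[of m] u[of m] \<rho>[of m] True by (intro eq_matI) (auto simp: col_mat_of_cols)
    then show ?thesis
      using True by simp
  qed auto
  show "?f m * ?g m = 1\<^sub>m (dim_at V m)" if m: "1 \<le> m" "m \<le> n" for m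
  proof (cases "i < m \<and> m \<le> j")
    case True
    have "mat_of_cols (dim_at V m) [u m] * mat_of_row (\<rho> m) = 1\<^sub>m (dim_at V m)"
    proof (rule eq_matI)
      fix a b assume "a < dim_row (1\<^sub>m (dim_at V m) :: 'k mat)" "b < dim_col (1\<^sub>m (dim_at V m) :: 'k mat)"
      then have ab: "a < dim_at V m" "b < dim_at V m" by auto
      have "unit_vec (dim_at V m) b = (\<rho> m \<bullet> unit_vec (dim_at V m) b) \<cdot>\<^sub>v u m"
        by (rule span) (use True in auto)
      then have "(unit_vec (dim_at V m) b :: 'k vec) $ a = \<rho> m $ b * u m $ a"
        using ab u[of m] True scalar_prod_right_unit[OF ab(2), of "\<rho> m"] by (metis carrier_vecD index_smult_vec(1))
      then show "(mat_of_cols (dim_at V m) [u m] * mat_of_row (\<rho> m)) $$ (a, b) = 1\<^sub>m (dim_at V m) $$ (a, b)"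
        using ab \<rho>[of m] True by (auto simp: scalar_prod_def mat_of_cols_index mult.commute)
    qed (use \<rho>[of m] True in auto)
    then show ?thesis
      using True by simp
  next
    case False
    then show ?thesis
      using outside[OF m] by auto
  qed
qed (use u ustep in auto)

text \<open>Start at the first vertex \<open>a\<close> in the support and go to the last vertex \<open>j\<close> with a nonzero
  composite \<open>V\<^sub>a \<rightarrow> V\<^sub>j\<close>.  A vector \<open>e\<close> surviving until \<open>j\<close> spans a subrepresentation; it is complemented
  by the preimages of the kernel of a functional on \<open>V\<^sub>j\<close> that does not vanish on the image of \<open>e\<close>.\<close>

lemma indecomposable_is_interval:
  fixes V :: "'k::field rep"
  assumes ind: "indecomposable n V"
  shows "\<exists>i j. i < j \<and> j \<le> n \<and> isomorphic n V (interval_module i j)"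
proof -
  define d where "d = dim_at V"
  have V: "V \<in> reps n" and ex: "\<exists>m. 1 \<le> m \<and> m \<le> n \<and> d m \<noteq> 0"
    using ind by (auto simp: indecomposable_def d_def)
  define a where "a = (LEAST m. 1 \<le> m \<and> m \<le> n \<and> d m \<noteq> 0)"
  have a: "1 \<le> a" "a \<le> n" "d a \<noteq> 0"
    using LeastI_ex[OF ex] by (simp_all add: a_def)
  have below: "d m = 0" if "1 \<le> m" "m < a" for m
    using not_less_Least[of m "\<lambda>m. 1 \<le> m \<and> m \<le> n \<and> d m \<noteq> 0"] that a by (simp add: a_def)
  define T where "T = {t. a + t \<le> n \<and> transport V a t \<noteq> 0\<^sub>m (d (a + t)) (d a)}"
  have fin: "finite T"
    by (rule finite_subset[of _ "{..n}"]) (auto simp: T_def)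
  have "0 \<in> T"
  proof -
    have "(1\<^sub>m (d a) :: 'k mat) $$ (0, 0) \<noteq> 0\<^sub>m (d a) (d a) $$ (0, 0)"
      using a(3) by simp
    then show ?thesis
      using a(2) by (auto simp: T_def d_def)
  qed
  then have MaxT: "Max T \<in> T" "\<And>t. t \<in> T \<Longrightarrow> t \<le> Max T"
    using Max_in[OF fin] Max_ge[OF fin] by blast+
  define t where "t = Max T"
  define j where "j = a + t"
  have j: "a \<le> j" "j \<le> n" and t_nz: "transport V a t \<noteq> 0\<^sub>m (d j) (d a)"
    using MaxT(1) by (auto simp: T_def j_def t_def)
  have t_max: "transport V a (Suc t) = 0\<^sub>m (d (Suc j)) (d a)" if "j < n"
    using MaxT(2)[of "Suc t"] that by (auto simp: T_def j_def t_def)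
  have tc: "transport V m s \<in> carrier_mat (d (m + s)) (d m)" if "1 \<le> m" "m + s \<le> n" for m s
    using transport_carrier[OF V that] by (simp add: d_def)
  have tcj: "transport V m (j - m) \<in> carrier_mat (d j) (d m)" if "a \<le> m" "m \<le> j" for m
    using tc[of m "j - m"] that a j by simp
  have tca: "transport V a (m - a) \<in> carrier_mat (d m) (d a)" if "a \<le> m" "m \<le> j" for m
    using tc[of a "m - a"] that a j by simp
  have tat: "transport V a t \<in> carrier_mat (d j) (d a)"
    using tc[of a t] a j by (simp add: j_def)
  obtain r c where rc: "r < d j" "c < d a" "transport V a t $$ (r, c) \<noteq> 0"
  proof -
    have "\<exists>r c. r < d j \<and> c < d a \<and> transport V a t $$ (r, c) \<noteq> 0"
    proof (rule ccontr)
      assume "\<not> ?thesis"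
      then have "transport V a t = 0\<^sub>m (d j) (d a)"
        using tat by (intro eq_matI) auto
      then show False
        using t_nz by blast
    qed
    then show ?thesis
      using that by blast
  qed
  \<comment> \<open>A nonzero entry of the composite supplies both choices: its column gives the
    vector \<open>e\<close> at \<open>a\<close>, its row the coordinate functional at
    \<open>j\<close>. Dividing by the entry \<open>N\<close> makes \<open>\<rho> m\<close> take the
    value 1 on \<open>u m\<close>.\<close>
  define N where "N = transport V a t $$ (r, c)"
  define e where "e = (unit_vec (d a) c :: 'k vec)"
  define u where "u m = (if a \<le> m \<and> m \<le> j then transport V a (m - a) *\<^sub>v e else 0\<^sub>v (d m))" for m
  define \<rho> where "\<rho> m = (if a \<le> m \<and> m \<le> j then (1 / N) \<cdot>\<^sub>v row (transport V m (j - m)) r else 0\<^sub>v (d m))" for m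
  have e: "e \<in> carrier_vec (d a)"
    by (simp add: e_def)
  have uc: "u m \<in> carrier_vec (d m)" for m
    unfolding u_def using mult_mat_vec_carrier[OF tca e] by simp
  have \<rho>c: "\<rho> m \<in> carrier_vec (d m)" for m
    using row_carrier_vec[OF rc(1) tcj, of m] by (simp add: \<rho>_def)
  have \<rho>_eval: "\<rho> m \<bullet> x = (transport V m (j - m) *\<^sub>v x) $ r / N"
    if "a \<le> m" "m \<le> j" "x \<in> carrier_vec (d m)" for m x
    using that tcj[of m] rc by (simp add: \<rho>_def)
  have arrow: "arrow V m \<in> carrier_mat (d (Suc m)) (d m)" if "1 \<le> m" "m < n" for m
    using arrow_carrier[OF V that] by (simp add: d_def)
  have \<rho>u: "\<rho> m \<bullet> u m = 1" if m: "a \<le> m" "m \<le> j" for m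
  proof -
    have "transport V a t = transport V m (j - m) * transport V a (m - a)"
      using transport_add[OF V a(1), of "m - a" "j - m"] m j by (simp add: j_def)
    then have "transport V m (j - m) *\<^sub>v u m = transport V a t *\<^sub>v e"
      using assoc_mult_mat_vec[OF tcj[OF m] tca[OF m] e] m by (simp add: u_def)
    moreover have "(transport V a t *\<^sub>v e) $ r = N"
      using tat rc by (simp add: e_def N_def)
    ultimately show ?thesis
      using \<rho>_eval[OF m uc] rc by (simp add: N_def)
  qed
  have ustep: "arrow V m *\<^sub>v u m = u (Suc m)" if m: "a \<le> m" "m < j" for m
    using transport_Suc_vec[OF V a(1), of "m - a" e] m j e by (simp add: u_def d_def Suc_diff_le)
  have ulast: "arrow V j *\<^sub>v u j = 0\<^sub>v (d (Suc j))" if "j < n"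
  proof -
    have "arrow V j *\<^sub>v u j = transport V a (Suc t) *\<^sub>v e"
      using transport_Suc_vec[OF V a(1), of t e] that e j by (simp add: u_def d_def j_def del: transport.simps)
    then show ?thesis
      using e t_max[OF that] by (auto intro!: eq_vecI)
  qed
  have \<rho>step: "\<rho> (Suc m) \<bullet> (arrow V m *\<^sub>v x) = \<rho> m \<bullet> x"
    if m: "a \<le> m" "m < j" and x: "x \<in> carrier_vec (d m)" for m x
  proof -
    have m': "1 \<le> m" "m < n" "Suc (j - Suc m) = j - m"
      using m a j by auto
    have "transport V m (1 + (j - Suc m)) = transport V (m + 1) (j - Suc m) * transport V m 1"
      by (rule transport_add[OF V m'(1)]) (use m j in simp)
    then have "transport V m (j - m) = transport V (Suc m) (j - Suc m) * arrow V m"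
      using m'(3) right_mult_one_mat[OF arrow[OF m'(1,2)]] by (simp add: d_def del: transport.simps(2)) (simp add: d_def)
    then have "transport V m (j - m) *\<^sub>v x = transport V (Suc m) (j - Suc m) *\<^sub>v (arrow V m *\<^sub>v x)"
      using assoc_mult_mat_vec[OF tcj[of "Suc m"] arrow[OF m'(1,2)] x] m by simp
    then show ?thesis
      using \<rho>_eval[of m x] \<rho>_eval[of "Suc m" "arrow V m *\<^sub>v x"] mult_mat_vec_carrier[OF arrow[OF m'(1,2)] x] m x
      by simp
  qed
  define U where "U m = {c \<cdot>\<^sub>v u m | c. True}" for m
  define W where "W m = {x \<in> carrier_vec (d m). \<rho> m \<bullet> x = 0}" for m
  have u0: "0\<^sub>v (d m) \<in> U m" for m
    using uc[of m] by (auto simp: U_def intro!: exI[of _ 0] eq_vecI)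
  have Usub: "subrep n V U"
    unfolding subrep_def
  proof (intro conjI ballI)
    fix m
    show "VectorSpace.subspace class_ring (U m) (module_vec TYPE('k) (dim_at V m))"
    proof (rule subspaceI)
      show "U m \<subseteq> carrier_vec (dim_at V m)"
        using uc[of m] by (auto simp: U_def d_def)
      show "0\<^sub>v (dim_at V m) \<in> U m"
        using u0 by (simp add: d_def)
      show "x + y \<in> U m" if "x \<in> U m" "y \<in> U m" for x y
        using that by (auto simp: U_def simp flip: add_smult_distrib_vec)
      show "b \<cdot>\<^sub>v x \<in> U m" if "x \<in> U m" for b x
        using that by (auto simp: U_def smult_smult_assoc)
    qed
  next
    fix m assume "m \<in> {1..<n}"
    then have m: "1 \<le> m" "m < n" by auto
    have "arrow V m *\<^sub>v u m \<in> U (Suc m)"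
    proof -
      consider "a \<le> m" "m < j" | "m = j" | "\<not> (a \<le> m \<and> m \<le> j)"
        by linarith
      then show ?thesis
      proof cases
        case 1
        then have "arrow V m *\<^sub>v u m = 1 \<cdot>\<^sub>v u (Suc m)"
          using ustep by simp
        then show ?thesis
          unfolding U_def by blast
      next
        case 2
        then show ?thesis
          using ulast m u0 by simp
      next
        case 3
        then have "arrow V m *\<^sub>v u m = 0\<^sub>v (d (Suc m))"
          using arrow[OF m] by (auto simp: u_def intro!: eq_vecI)
        then show ?thesis
          using u0 by simp
      qed
    qed
    then obtain b where b: "arrow V m *\<^sub>v u m = b \<cdot>\<^sub>v u (Suc m)"
      by (auto simp: U_def)
    have "arrow V m *\<^sub>v (b' \<cdot>\<^sub>v u m) = (b' * b) \<cdot>\<^sub>v u (Suc m)" for b'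
      using mult_mat_vec[OF arrow[OF m] uc] by (simp add: b smult_smult_assoc)
    then show "(*\<^sub>v) (arrow V m) ` U m \<subseteq> U (m + 1)"
      unfolding U_def by auto
  qed
  have Wsub: "subrep n V W"
    unfolding subrep_def
  proof (intro conjI ballI)
    fix m
    show "VectorSpace.subspace class_ring (W m) (module_vec TYPE('k) (dim_at V m))"
      by (rule subspaceI)
        (use \<rho>c[of m] in \<open>auto simp: W_def d_def scalar_prod_add_distrib[of _ "dim_at V m"]\<close>)
  next
    fix m assume "m \<in> {1..<n}"
    then have m: "1 \<le> m" "m < n" by auto
    have "arrow V m *\<^sub>v x \<in> W (Suc m)" if x: "x \<in> W m" for x
    proof -
      have xc: "x \<in> carrier_vec (d m)" "\<rho> m \<bullet> x = 0"
        using x by (auto simp: W_def)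
      have Ax: "arrow V m *\<^sub>v x \<in> carrier_vec (d (Suc m))"
        by (rule mult_mat_vec_carrier[OF arrow[OF m] xc(1)])
      \<comment> \<open>Just before \<open>a\<close> the functional is zero while at
        \<open>a\<close> it is not, so stability of \<open>W\<close> on that arrow depends on
        \<open>a\<close> being the first vertex of the support. After \<open>j\<close> the
        functional is zero again and imposes no condition.\<close>
      consider "a \<le> m" "m < j" | "m < a" | "\<not> (a \<le> Suc m \<and> Suc m \<le> j)"
        by linarith
      then have "\<rho> (Suc m) \<bullet> (arrow V m *\<^sub>v x) = 0"
      proof cases
        case 1
        then show ?thesis
          using \<rho>step xc by simp
      next
        case 2
        then have "arrow V m *\<^sub>v x = 0\<^sub>v (d (Suc m))"
          using below[OF m(1)] xc(1) arrow[OF m] by (intro eq_vecI) (auto simp: scalar_prod_def)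
        then show ?thesis
          using \<rho>c by simp
      next
        case 3
        then have "\<rho> (Suc m) = 0\<^sub>v (d (Suc m))"
          by (auto simp: \<rho>_def)
        then show ?thesis
          using Ax by simp
      qed
      then show ?thesis
        using Ax by (simp add: W_def)
    qed
    then show "(*\<^sub>v) (arrow V m) ` W m \<subseteq> W (m + 1)"
      by auto
  qed
  have sum: "{u + w |u w. u \<in> U m \<and> w \<in> W m} = carrier_vec (d m)" for m
  proof
    show "{u + w |u w. u \<in> U m \<and> w \<in> W m} \<subseteq> carrier_vec (d m)"
      using uc[of m] by (auto simp: U_def W_def)
    show "carrier_vec (d m) \<subseteq> {u + w |u w. u \<in> U m \<and> w \<in> W m}"
    proof
      fix x :: "'k vec" assume x: "x \<in> carrier_vec (d m)"
      define y where "y = (\<rho> m \<bullet> x) \<cdot>\<^sub>v u m"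
      have y: "y \<in> carrier_vec (d m)" "y \<in> U m"
        using uc[of m] by (auto simp: y_def U_def)
      have "\<rho> m \<bullet> y = \<rho> m \<bullet> x"
      proof (cases "a \<le> m \<and> m \<le> j")
        case True
        then show ?thesis
          using \<rho>u[of m] scalar_prod_smult_distrib[OF \<rho>c uc] by (simp add: y_def)
      next
        case False
        then have "\<rho> m = 0\<^sub>v (d m)"
          by (auto simp: \<rho>_def)
        then show ?thesis
          using x y(1) by simp
      qed
      then have "x - y \<in> W m"
        using scalar_prod_minus_distrib[OF \<rho>c x y(1)] x y(1) by (simp add: W_def)
      moreover have "x = y + (x - y)"
        using x y(1) by (intro eq_vecI) auto
      ultimately show "x \<in> {u + w |u w. u \<in> U m \<and> w \<in> W m}"
        using y(2) by blast
    qed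
  qed
  have int: "U m \<inter> W m = {0\<^sub>v (d m)}" for m
  proof
    show "{0\<^sub>v (d m)} \<subseteq> U m \<inter> W m"
      using u0[of m] \<rho>c[of m] by (auto simp: W_def)
    show "U m \<inter> W m \<subseteq> {0\<^sub>v (d m)}"
    proof
      fix x assume "x \<in> U m \<inter> W m"
      then obtain b where b: "x = b \<cdot>\<^sub>v u m" "\<rho> m \<bullet> x = 0"
        by (auto simp: U_def W_def)
      show "x \<in> {0\<^sub>v (d m)}"
      proof (cases "a \<le> m \<and> m \<le> j")
        case True
        then have "b = 0"
          using \<rho>u[of m] scalar_prod_smult_distrib[OF \<rho>c uc] b by simp
        then show ?thesis
          using uc[of m] b by (auto intro!: eq_vecI)
      next
        case False
        then show ?thesis
          by (auto simp: b u_def)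
      qed
    qed
  qed
  have "(\<forall>m\<in>{1..n}. U m = {0\<^sub>v (d m)}) \<or> (\<forall>m\<in>{1..n}. W m = {0\<^sub>v (d m)})"
    using ind Usub Wsub sum int unfolding indecomposable_def d_def by blast
  moreover have "U a \<noteq> {0\<^sub>v (d a)}"
  proof
    assume "U a = {0\<^sub>v (d a)}"
    moreover have "1 \<cdot>\<^sub>v u a \<in> U a"
      unfolding U_def by blast
    ultimately have "u a = 0\<^sub>v (d a)"
      by simp
    then show False
      using \<rho>u[of a] j \<rho>c[of a] by simp
  qed
  ultimately have W0: "x = 0\<^sub>v (d m)" if "1 \<le> m" "m \<le> n" "x \<in> carrier_vec (d m)" "\<rho> m \<bullet> x = 0" for m x
    using that a unfolding W_def by fastforce
  \<comment> \<open>Outside \<open>[a,j]\<close> the functional is zero, so \<open>W m\<close> is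
    the whole space; the vanishing of \<open>W\<close> then forces dimension 0.\<close>
  have outside: "d m = 0" if m: "1 \<le> m" "m \<le> n" and out: "\<not> (a \<le> m \<and> m \<le> j)" for m
  proof (rule ccontr)
    assume "d m \<noteq> 0"
    moreover have "\<rho> m = 0\<^sub>v (d m)"
      using out by (auto simp: \<rho>_def)
    then have "unit_vec (d m) 0 = (0\<^sub>v (d m) :: 'k vec)"
      by (intro W0[OF m]) simp_all
    ultimately show False
      by simp
  qed
  have span: "x = (\<rho> m \<bullet> x) \<cdot>\<^sub>v u m" if m: "a \<le> m" "m \<le> j" and x: "x \<in> carrier_vec (d m)" for m x
  proof -
    obtain y w where yw: "x = y + w" "y \<in> U m" "w \<in> W m"
      using x sum[of m] by blast
    have "w = 0\<^sub>v (d m)"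
      using W0[of m w] yw(3) m a j by (auto simp: W_def)
    obtain b where b: "y = b \<cdot>\<^sub>v u m"
      using yw(2) by (auto simp: U_def)
    have "x = b \<cdot>\<^sub>v u m"
      using yw(1) b uc[of m] \<open>w = 0\<^sub>v (d m)\<close> by simp
    moreover from this have "\<rho> m \<bullet> x = b"
      using scalar_prod_smult_distrib[OF \<rho>c uc] \<rho>u[OF m] by simp
    ultimately show ?thesis
      by simp
  qed
  \<comment> \<open>Intervals are half open on the left, so support starting at \<open>a\<close>
    means left index \<open>a - 1\<close>; \<open>a \<ge> 1\<close> keeps the subtraction
    exact.\<close>
  have a': "a - 1 < m \<longleftrightarrow> a \<le> m" for m
    using a by auto
  have "isomorphic n (interval_module (a - 1) j) V"
    by (rule interval_if_split_off[OF V, of _ _ u \<rho>])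
      (use a j uc \<rho>c ustep ulast \<rho>u span outside in \<open>simp_all only: a' flip: d_def\<close>)
  moreover have "a - 1 < j"
    using a j by simp
  ultimately show ?thesis
    using isomorphic_sym j(2) by blast
qed

text \<open>An identity cannot factor through a space of dimension 0. Comparing supports in this way
  is enough to tell interval modules apart.\<close>

lemma isomorphic_dim_zero:
  assumes "isomorphic n V W" "1 \<le> m" "m \<le> n" "dim_at V m = 0"
  shows "dim_at W m = 0"
proof (rule ccontr)
  assume nz: "dim_at W m \<noteq> 0"
  obtain f g where fg: "f \<in> homs n V W" "g \<in> homs n W V"
    "\<And>m. 1 \<le> m \<Longrightarrow> m \<le> n \<Longrightarrow> g m * f m = 1\<^sub>m (dim_at V m)"
    "\<And>m. 1 \<le> m \<Longrightarrow> m \<le> n \<Longrightarrow> f m * g m = 1\<^sub>m (dim_at W m)"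
    using isomorphicE[OF assms(1)] by blast
  have "(f m * g m) $$ (0, 0) = 0"
    using hom_carrier[OF fg(1) assms(2,3)] hom_carrier[OF fg(2) assms(2,3)] assms(4) nz
    by (auto simp: scalar_prod_def)
  then show False
    using fg(4)[OF assms(2,3)] nz by simp
qed

lemma isomorphic_intervals:
  assumes iso: "isomorphic n (interval_module i j :: 'k::field rep) (interval_module k l)"
    and ij: "i < j" "j \<le> n" and kl: "k < l" "l \<le> n"
  shows "i = k \<and> j = l"
proof -
  have iff: "i < m \<and> m \<le> j \<longleftrightarrow> k < m \<and> m \<le> l" if "1 \<le> m" "m \<le> n" for m
    using isomorphic_dim_zero[OF iso that] isomorphic_dim_zero[OF isomorphic_sym[OF iso] that]
    unfolding dim_interval_eq_0 by blast
  have "k \<le> i" "i \<le> k"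
    using iff[of "Suc i"] iff[of "Suc k"] ij kl by auto
  moreover have "j \<le> l" "l \<le> j"
    using iff[of j] iff[of l] ij kl by auto
  ultimately show ?thesis
    by simp
qed

lemma exceptional_interval:
  assumes "i < j" "j \<le> n"
  shows "exceptional n (interval_module i j :: 'k::field rep)"
  unfolding exceptional_def
  using indecomposable_interval[OF assms] Ext1_zero_interval[of i i j j n] assms by auto

section \<open>The bijection\<close>

definition interval_class :: "nat \<Rightarrow> strand \<Rightarrow> 'k::field rep set" where
  "interval_class n = (\<lambda>(i, j). iso_class n (interval_module i j))"

lemma interval_pair_iff:
  assumes "X \<in> strands_on 0 n" "Y \<in> strands_on 0 n"
  shows "Hom_zero n (case_prod interval_module X) (case_prod interval_module Y :: 'k::field rep) \<and>
      Ext1_zero n (case_prod interval_module X) (case_prod interval_module Y :: 'k rep) \<longleftrightarrow> \<not> nonorth X Y"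
proof -
  obtain i j k l where XY: "X = (i, j)" "Y = (k, l)"
    by fastforce
  with assms have *: "i < j" "j \<le> n" "k < l" "l \<le> n"
    by (auto simp: strands_on_def)
  have "Hom_zero n (interval_module i j) (interval_module k l :: 'k rep) \<longleftrightarrow> \<not> (k \<le> i \<and> i < l \<and> l \<le> j)"
    using Hom_zero_interval[of k i l j n] Hom_nonzero_interval[of k i l j n] * by blast
  moreover have "Ext1_zero n (interval_module i j) (interval_module k l :: 'k rep) \<longleftrightarrow> \<not> (i < k \<and> k \<le> j \<and> j < l)"
    using Ext1_zero_interval[of i k j l n] Ext1_nonzero_interval[of i k j l n] * by blast
  ultimately show ?thesis
    by (auto simp: XY nonorth_def)
qed

lemma inj_on_interval_class: "inj_on (interval_class n :: strand \<Rightarrow> 'k::field rep set) (strands_on 0 n)"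
proof (rule inj_onI)
  fix X Y assume XY: "X \<in> strands_on 0 n" "Y \<in> strands_on 0 n"
    "interval_class n X = (interval_class n Y :: 'k rep set)"
  obtain i j k l where "X = (i, j)" "Y = (k, l)"
    by fastforce
  then show "X = Y"
    using XY isomorphic_intervals[of n i j k l]
    by (auto simp: interval_class_def strands_on_def iso_class_eq_iff)
qed

text \<open>Replacing each term by an isomorphic interval module preserves the vanishing of Hom and
  Ext, so the strands inherit the order of the sequence.\<close>

lemma exceptional_setsD:
  assumes S: "S \<in> (exceptional_sets n :: 'k::field rep set set set)"
  shows "\<exists>xs. length xs = n \<and> set xs \<subseteq> strands_on 0 n \<and> exc_list xs \<and> S = interval_class n ` set xs"
proof -
  obtain Vs :: "'k rep list" where Vs: "length Vs = n" "exceptional_sequence n Vs" "S = iso_class n ` set Vs"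
    using S by (auto simp: exceptional_sets_def)
  have ind: "indecomposable n V" if "V \<in> set Vs" for V
    using Vs(2) that by (auto simp: exceptional_sequence_def exceptional_def)
  have "\<exists>X. X \<in> strands_on 0 n \<and> isomorphic n V (case_prod interval_module X)" if "V \<in> set Vs" for V
    using indecomposable_is_interval[OF ind[OF that]] by (auto simp: strands_on_def)
  then obtain \<sigma> where \<sigma>: "\<sigma> V \<in> strands_on 0 n" "isomorphic n V (case_prod interval_module (\<sigma> V))"
    if "V \<in> set Vs" for V
    by metis
  have reps: "V \<in> reps n" if "V \<in> set Vs" for V
    using ind[OF that] by (simp add: indecomposable_def)
  have int_reps: "case_prod interval_module X \<in> reps n" for X
    by (simp add: case_prod_beta)
  have "exc_list (map \<sigma> Vs)"
    unfolding exc_list_def sorted_wrt_iff_nth_less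
  proof (intro allI impI)
    fix q p assume qp: "q < p" "p < length (map \<sigma> Vs)"
    then have *: "Vs ! p \<in> set Vs" "Vs ! q \<in> set Vs"
      by auto
    have "Hom_zero n (Vs ! p) (Vs ! q)" "Ext1_zero n (Vs ! p) (Vs ! q)"
      using Vs(2) qp by (simp_all add: exceptional_sequence_def)
    then have "Hom_zero n (case_prod interval_module (\<sigma> (Vs ! p))) (case_prod interval_module (\<sigma> (Vs ! q)) :: 'k rep)"
      "Ext1_zero n (case_prod interval_module (\<sigma> (Vs ! p))) (case_prod interval_module (\<sigma> (Vs ! q)) :: 'k rep)"
      using Hom_zero_isomorphic[OF reps[OF *(1)] int_reps reps[OF *(2)] int_reps \<sigma>(2)[OF *(1)] \<sigma>(2)[OF *(2)]]
        Ext1_zero_isomorphic[OF reps[OF *(1)] int_reps reps[OF *(2)] int_reps \<sigma>(2)[OF *(1)] \<sigma>(2)[OF *(2)]]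
      by blast+
    then have "\<not> nonorth (\<sigma> (Vs ! p)) (\<sigma> (Vs ! q))"
      using interval_pair_iff[OF \<sigma>(1)[OF *(1)] \<sigma>(1)[OF *(2)]] by blast
    then show "\<not> nonorth (map \<sigma> Vs ! p) (map \<sigma> Vs ! q)"
      using qp by simp
  qed
  moreover have "iso_class n V = interval_class n (\<sigma> V)" if "V \<in> set Vs" for V
  proof -
    have "interval_class n (\<sigma> V) = iso_class n (case_prod interval_module (\<sigma> V) :: 'k rep)"
      by (simp add: interval_class_def case_prod_beta)
    then show ?thesis
      using iso_class_eq_iff[OF reps[OF that] int_reps] \<sigma>(2)[OF that] by simp
  qed
  then have "S = interval_class n ` set (map \<sigma> Vs)"
    unfolding Vs(3) by (simp add: image_image)
  ultimately show ?thesis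
    using Vs(1) \<sigma>(1) by (intro exI[of _ "map \<sigma> Vs"]) auto
qed

lemma exceptional_setsI:
  assumes xs: "set xs \<subseteq> strands_on 0 n" "exc_list xs" "length xs = n"
  shows "interval_class n ` set xs \<in> (exceptional_sets n :: 'k::field rep set set set)"
  unfolding exceptional_sets_def
proof (intro CollectI conjI exI)
  have "distinct xs"
    using xs(1) by (intro exc_list_distinct[OF xs(2)]) (auto simp: strands_on_def)
  moreover have "inj_on (interval_class n :: strand \<Rightarrow> 'k rep set) (set xs)"
    using inj_on_subset[OF inj_on_interval_class xs(1)] .
  ultimately show "card (interval_class n ` set xs :: 'k rep set set) = n"
    by (simp add: card_image distinct_card xs(3))
  let ?Vs = "map (case_prod interval_module) xs :: 'k rep list"
  show "length ?Vs = n"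
    using xs(3) by simp
  show "interval_class n ` set xs = iso_class n ` set ?Vs"
    by (simp add: image_image interval_class_def case_prod_beta)
  show "exceptional_sequence n ?Vs"
    unfolding exceptional_sequence_def
  proof (intro conjI ballI allI impI)
    show "exceptional n V" if "V \<in> set ?Vs" for V
      using that xs(1) by (auto simp: strands_on_def intro!: exceptional_interval)
    fix p q assume pq: "p < length ?Vs" "q < p"
    then have "\<not> nonorth (xs ! p) (xs ! q)" "xs ! p \<in> strands_on 0 n" "xs ! q \<in> strands_on 0 n"
      using xs by (auto simp: exc_list_def sorted_wrt_iff_nth_less)
    then have "Hom_zero n (?Vs ! p) (?Vs ! q) \<and> Ext1_zero n (?Vs ! p) (?Vs ! q)"
      using pq interval_pair_iff[of "xs ! p" n "xs ! q", where ?'k = 'k] by simp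
    then show "Hom_zero n (?Vs ! p) (?Vs ! q)" "Ext1_zero n (?Vs ! p) (?Vs ! q)"
      by simp_all
  qed
qed

lemma strands_interval_class:
  assumes "D \<subseteq> strands_on 0 n"
  shows "strands n (interval_class n ` D :: 'k::field rep set set) = D"
proof -
  have "(i, j) \<in> strands n (interval_class n ` D :: 'k rep set set) \<longleftrightarrow>
      (i, j) \<in> strands_on 0 n \<and> interval_class n (i, j) \<in> (interval_class n ` D :: 'k rep set set)" for i j
    by (auto simp: strands_def strands_on_def interval_class_def)
  moreover have "(i, j) \<in> strands_on 0 n \<and> interval_class n (i, j) \<in> (interval_class n ` D :: 'k rep set set)
      \<longleftrightarrow> (i, j) \<in> D" for i j
    using inj_on_image_mem_iff[OF inj_on_interval_class[where ?'k = 'k] _ assms, of "(i, j)"] assms by blast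
  ultimately show ?thesis
    by auto
qed

text \<open>The \<open>n\<close> strands attain the maximum on the vertices from 0 to
  \<open>n\<close>, so the equality case of \<open>ranked_eq_place\<close> applies.\<close>

lemma exceptional_set_place:
  assumes "S \<in> (exceptional_sets n :: 'k::field rep set set set)"
  shows "\<exists>t. num_nodes t = n \<and> S = interval_class n ` right_strands 0 (t :: unit ttree)"
proof -
  obtain xs where xs: "length xs = n" "set xs \<subseteq> strands_on 0 n" "exc_list xs" "S = interval_class n ` set xs"
    using exceptional_setsD[OF assms] by blast
  obtain \<rho> where \<rho>: "ranked \<rho> (set xs)"
    using exc_list_rank[OF xs(3)] unfolding ranked_def by blast
  have "distinct xs"
    using xs(2) by (intro exc_list_distinct[OF xs(3)]) (auto simp: strands_on_def)
  then have "card (set xs) = n - 0"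
    using xs(1) by (simp add: distinct_card)
  then show ?thesis
    using ranked_eq_place[OF \<rho> xs(2)] xs(4) by fastforce
qed

lemma place_exceptional_set:
  fixes t :: "unit ttree"
  assumes "num_nodes t = n"
  shows "interval_class n ` right_strands 0 t \<in> (exceptional_sets n :: 'k::field rep set set set)"
proof -
  obtain xs where "set xs = right_strands 0 t" "length xs = n" "exc_list xs"
    using place_exc_list(1)[of 0 t] assms by blast
  then show ?thesis
    using exceptional_setsI[of xs n] place_strands_on(1)[of 0 t] assms by simp
qed

text \<open>An exceptional ordering of the same strands is repetition-free and has
  \<open>num_nodes t\<close> entries, so the strand set has as many elements as the label list has
  entries.\<close>

lemma distinct_right_strands: "distinct (node_labels (place_right p t))"
proof -
  obtain xs where xs: "set xs = right_strands p t" "length xs = num_nodes t" "exc_list xs"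
    using place_exc_list(1) by blast
  have "distinct xs"
    using place_bounds(1) by (intro exc_list_distinct[OF xs(3)]) (fastforce simp: xs(1))
  then have "card (right_strands p t) = num_nodes t"
    using xs by (metis distinct_card)
  then show ?thesis
    by (simp add: card_distinct)
qed

lemma strand_tree_place:
  fixes t :: "unit ttree"
  assumes t: "num_nodes t = n" and n: "n \<ge> 1"
  defines "S \<equiv> interval_class n ` right_strands 0 t :: 'k::field rep set set"
  shows "is_strand_tree n S t' \<longleftrightarrow> t' = place_right 0 t"
    and "object_tree n S = map_ttree (interval_class n) (place_right 0 t)"
proof -
  have "strands n S = right_strands 0 t"
    unfolding S_def by (rule strands_interval_class) (use place_strands_on(1)[of 0 t] t in simp)
  then have *: "is_strand_tree n S t' \<longleftrightarrow> t' = place_right 0 t" for t'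
    unfolding is_strand_tree_def using grows_right_strands[of t] grows_unique t n by metis
  then show "is_strand_tree n S t' \<longleftrightarrow> t' = place_right 0 t" .
  show "object_tree n S = map_ttree (interval_class n) (place_right 0 t)"
    unfolding object_tree_def * by (simp add: interval_class_def)
qed

theorem lemma6p5:
  fixes n :: nat
  assumes "n \<ge> 1"
  shows "(\<forall>S \<in> (exceptional_sets n :: 'k::field rep set set set).
            (\<exists>!t. is_strand_tree n S t) \<and>
            distinct (node_labels (object_tree n S)) \<and>
            set (node_labels (object_tree n S)) = S \<and>
            num_nodes (object_tree n S) = n \<and>
            num_leaves (object_tree n S) = 2 * n + 1) \<and>
         bij_betw (\<lambda>S. shape (object_tree n S))
           (exceptional_sets n :: 'k rep set set set)
           {t. num_nodes t = n}"
proof (intro conjI ballI)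
  fix S :: "'k rep set set" assume "S \<in> exceptional_sets n"
  then obtain t :: "unit ttree" where t: "num_nodes t = n" and S: "S = interval_class n ` right_strands 0 t"
    using exceptional_set_place by blast
  note tree = strand_tree_place[OF t assms, where ?'k = 'k, folded S]
  show "\<exists>!t. is_strand_tree n S t"
    by (simp add: tree)
  have "inj_on (interval_class n :: strand \<Rightarrow> 'k rep set) (right_strands 0 t)"
    by (rule inj_on_subset[OF inj_on_interval_class]) (use place_strands_on(1)[of 0 t] t in simp)
  then show "distinct (node_labels (object_tree n S))"
    by (simp add: tree distinct_map distinct_right_strands)
  show "set (node_labels (object_tree n S)) = S"
    by (simp add: tree) (simp add: S)
  show "num_nodes (object_tree n S) = n"
    by (simp add: tree t)
  then show "num_leaves (object_tree n S) = 2 * n + 1"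
    by (simp add: num_leaves_eq)
next
  show "bij_betw (\<lambda>S. shape (object_tree n S)) (exceptional_sets n :: 'k rep set set set) {t. num_nodes t = n}"
  \<comment> \<open>The inverse places the bare tree at 0: subtree sizes alone determine the labels,
    and placing a tree and forgetting the labels returns it.\<close>
  proof (rule bij_betw_byWitness[where f' = "\<lambda>t. interval_class n ` right_strands 0 t"])
    show "\<forall>S \<in> (exceptional_sets n :: 'k rep set set set).
        interval_class n ` right_strands 0 (shape (object_tree n S)) = S"
      using exceptional_set_place strand_tree_place(2) assms by (metis shape_place(1))
    show "\<forall>t \<in> {t. num_nodes t = n}.
        shape (object_tree n (interval_class n ` right_strands 0 t :: 'k rep set set)) = t"
      using strand_tree_place(2) assms by (metis mem_Collect_eq shape_place(1))
    show "(\<lambda>S. shape (object_tree n S)) ` (exceptional_sets n :: 'k rep set set set) \<subseteq> {t. num_nodes t = n}"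
    proof (rule image_subsetI)
      fix S :: "'k rep set set" assume "S \<in> exceptional_sets n"
      then obtain t :: "unit ttree" where t: "num_nodes t = n" "S = interval_class n ` right_strands 0 t"
        using exceptional_set_place by blast
      then show "shape (object_tree n S) \<in> {t. num_nodes t = n}"
        using strand_tree_place(2)[OF t(1) assms, where ?'k = 'k] by simp
    qed
    show "(\<lambda>t :: unit ttree. interval_class n ` right_strands 0 t) ` {t. num_nodes t = n}
        \<subseteq> (exceptional_sets n :: 'k rep set set set)"
      by (rule image_subsetI) (simp add: place_exceptional_set)
  qed
qed

end
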